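(* Let $O$ be an octonion division algebra over a field $F$ of characteristic $0$, let $c_0,c_1\in O$ with $c_0\neq 0$, and consider the left linear recurrence of order $2$ $$a_{k+2}=-c_0a_k-c_1a_{k+1}\qquad(k\ge 0)$$ with fixed initial conditions $a_0,a_1\in O$. Let $p(x)=x^2+c_1x+c_0\in O[x]$ be its primitive characteristic polynomial, and let $\overline{p(x)}=x^2+\overline{c_1}x+\overline{c_0}$ be the conjugate polynomial. Assume that $p(x)$ has a unique root $\lambda\in O$. Then $\overline{p(x)}$ also has a unique root $\mu\in O$, which is in the same conjugacy class as $\lambda$, and there exist a quaternion subalgebra $Q\subset O$ containing the coefficients of $p(x)$, an element $\ell\in O$ with $\ell+\bar\ell=0$ and $O=Q\oplus Q\ell$, constants $b_1,b_2,b_3,b_4\in Q$, and linear polynomials $p_1(x),p_2(x),p_3(x),p_4(x)\in Q[x]$ such that the solution of the left linear recurrence with these initial conditions is $$a_k=(p_1(k)\lambda^k)b_1+(p_2(k)\lambda^k)b_2+\left((b_3\bar{\mu}^{\,k})p_3(k)+(b_4\bar{\mu}^{\,k})p_4(k)\right)\ell\qquad\text{for all }k\ge 0.$$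
   Context: An octonion algebra over $F$ is an $8$-dimensional (non-associative, unital, alternative) $F$-algebra obtained by the Cayley--Dickson doubling process from a quaternion algebra $A$ over $F$ with its standard involution $\sigma$: for $\gamma\in F^\times$ it is $A\oplus A\ell$ with multiplication $$(q+r\ell)(s+t\ell)=qs+\gamma\,\sigma(t)r+(tq+r\sigma(s))\ell,\qquad q,r,s,t\in A,$$ and with involution $\sigma(q+r\ell)=\sigma(q)-r\ell$. It is an octonion division algebra if it is a division algebra. The involution is written $\tau\mapsto\bar\tau$, and the trace of $\tau$ is $\tau+\bar\tau$. Polynomials in $O[x]$ (and in $Q[x]$) have a central indeterminate $x$ and coefficients on the left; $\lambda\in O$ is a root of $x^2+c_1x+c_0$ if $\lambda^2+c_1\lambda+c_0=0$. "Linear polynomial" means a polynomial of degree at most $1$ (constants allowed). Two elements $d_1,d_2\in O$ are conjugate if $d_1=qd_2q^{-1}$ for some nonzero $q\in O$ (well defined since any two elements of $O$ generate an associative subalgebra). The conjugacy class of an element is the set of its conjugates. *)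

theory Defs
  imports "HOL-Computational_Algebra.Polynomial"
begin

text \<open>Multiplication, unit and powers are the purely syntactic class operations on \<open>'o\<close>;
  no associativity or commutativity is assumed. A power \<open>x ^ n\<close> is bracketed to the right.\<close>

locale unital_algebra = vector_space scale
  for scale :: "'f::field \<Rightarrow> 'o::{ab_group_add, power} \<Rightarrow> 'o" (infixr "*s" 75) +
  assumes mult_add_left: "((x::'o) + y) * z = x * z + y * z"
    and mult_add_right: "(x::'o) * (y + z) = x * y + x * z"
    and mult_scale_left: "(c *s x) * y = c *s (x * y)"
    and mult_scale_right: "x * (c *s y) = c *s (x * y)"
    and mult_one_left: "1 * (x::'o) = x"
    and mult_one_right: "(x::'o) * 1 = x"
begin

definition subalgebra :: "'o set \<Rightarrow> bool" where
  "subalgebra A \<longleftrightarrow> subspace A \<and> 1 \<in> A \<and> (\<forall>x\<in>A. \<forall>y\<in>A. x * y \<in> A)"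

text \<open>\<open>A\<close> is the quaternion algebra \<open>(\<alpha>, \<beta>)\<close> with standard generators \<open>i\<close>, \<open>j\<close>
  (the usual presentation in characteristic different from 2). The ambient algebra is not
  assumed associative, so associativity of \<open>A\<close> has to be required.\<close>

definition quaternion_generators :: "'o set \<Rightarrow> 'o \<Rightarrow> 'o \<Rightarrow> bool" where
  "quaternion_generators A i j \<longleftrightarrow>
     subalgebra A \<and>
     (\<forall>x\<in>A. \<forall>y\<in>A. \<forall>z\<in>A. (x * y) * z = x * (y * z)) \<and>
     card {1, i, j, i * j} = 4 \<and> independent {1, i, j, i * j} \<and> span {1, i, j, i * j} = A \<and>
     (\<exists>\<alpha> \<beta>. \<alpha> \<noteq> 0 \<and> \<beta> \<noteq> 0 \<and> i * i = \<alpha> *s 1 \<and> j * j = \<beta> *s 1) \<and>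
     j * i = - (i * j)"

definition quaternion_subalgebra :: "'o set \<Rightarrow> bool" where
  "quaternion_subalgebra A \<longleftrightarrow> (\<exists>i j. quaternion_generators A i j)"

definition standard_involution :: "'o set \<Rightarrow> ('o \<Rightarrow> 'o) \<Rightarrow> bool" where
  "standard_involution A \<sigma> \<longleftrightarrow>
     (\<exists>i j. quaternion_generators A i j \<and>
        (\<forall>w x y z. \<sigma> (w *s 1 + x *s i + y *s j + z *s (i * j)) =
                   w *s 1 - x *s i - y *s j - z *s (i * j)))"

definition direct_double :: "'o set \<Rightarrow> 'o \<Rightarrow> bool" where
  "direct_double A l \<longleftrightarrow> (\<forall>x. \<exists>!(q, r). q \<in> A \<and> r \<in> A \<and> x = q + r * l)"

definition cayley_dickson_double :: "('o \<Rightarrow> 'o) \<Rightarrow> 'o set \<Rightarrow> 'f \<Rightarrow> 'o \<Rightarrow> bool" where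
  "cayley_dickson_double \<sigma> A \<gamma> l \<longleftrightarrow>
     \<gamma> \<noteq> 0 \<and> direct_double A l \<and>
     (\<forall>q\<in>A. \<forall>r\<in>A. \<forall>s\<in>A. \<forall>t\<in>A.
        (q + r * l) * (s + t * l) =
          (q * s + \<gamma> *s (\<sigma> t * r)) + (t * q + r * \<sigma> s) * l)"

end

text \<open>The involution \<open>conj\<close> is part of the data, but it is determined by the algebra:
  its restriction to the quaternion algebra \<open>A\<close> is the standard involution, and it is
  extended to the double by the Cayley--Dickson rule.\<close>

locale octonion_algebra = unital_algebra scale
  for scale :: "'f::field \<Rightarrow> 'o::{ab_group_add, power} \<Rightarrow> 'o" (infixr "*s" 75) +
  fixes conj :: "'o \<Rightarrow> 'o"
  assumes doubling: "\<exists>A \<gamma> l. quaternion_subalgebra A \<and> standard_involution A conj \<and>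
      cayley_dickson_double conj A \<gamma> l \<and>
      (\<forall>q\<in>A. \<forall>r\<in>A. conj (q + r * l) = conj q - r * l)"

locale octonion_division_algebra = octonion_algebra scale conj
  for scale :: "'f::field \<Rightarrow> 'o::{ab_group_add, power} \<Rightarrow> 'o" (infixr "*s" 75)
    and conj :: "'o \<Rightarrow> 'o" +
  assumes left_division: "(a::'o) \<noteq> 0 \<Longrightarrow> \<exists>!x. a * x = b"
    and right_division: "(a::'o) \<noteq> 0 \<Longrightarrow> \<exists>!y. y * a = b"

definition conjugacy_class :: "'o::{zero, power} \<Rightarrow> 'o set" where
  "conjugacy_class d = {(q * d) * q' | q q'. q \<noteq> 0 \<and> q * q' = 1 \<and> q' * q = 1}"

text \<open>Evaluation with coefficients on the left; the library's \<open>poly\<close> needs a commutative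
  semiring of coefficients.\<close>

definition left_eval :: "'o::{ab_group_add, power} poly \<Rightarrow> 'o \<Rightarrow> 'o" where
  "left_eval p z = (\<Sum>n\<le>degree p. coeff p n * z ^ n)"

definition unique_root :: "'o::{ab_group_add, power} poly \<Rightarrow> 'o \<Rightarrow> bool" where
  "unique_root p z \<longleftrightarrow> left_eval p z = 0 \<and> (\<forall>w. left_eval p w = 0 \<longrightarrow> w = z)"

definition eval_nat ::
  "('f::field \<Rightarrow> 'o::{ab_group_add, power} \<Rightarrow> 'o) \<Rightarrow> 'o poly \<Rightarrow> nat \<Rightarrow> 'o" where
  "eval_nat scale p k = left_eval p (scale (of_nat k) 1)"

definition linear_poly_over :: "'o::zero set \<Rightarrow> 'o poly \<Rightarrow> bool" where
  "linear_poly_over A p \<longleftrightarrow> degree p \<le> 1 \<and> (\<forall>n. coeff p n \<in> A)"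

definition left_recurrence :: "'o::{ab_group_add, power} \<Rightarrow> 'o \<Rightarrow> (nat \<Rightarrow> 'o) \<Rightarrow> bool" where
  "left_recurrence c0 c1 a \<longleftrightarrow> (\<forall>k. a (k + 2) = - (c0 * a k) - c1 * a (k + 1))"

definition recurrence_poly :: "'o::{zero, one} \<Rightarrow> 'o \<Rightarrow> 'o poly" where
  "recurrence_poly c0 c1 = [:c0, c1, 1:]"

end

theory Submission imports Defs begin

text \<open>Let \<open>nu = - c1 - lam\<close>. Then \<open>c0 = nu * lam\<close>, so the characteristic polynomial is
  \<open>(x - nu) * (x - lam)\<close>. The elements \<open>lam\<close> and \<open>nu\<close> lie in a quaternion
  subalgebra \<open>Q\<close>, and the octonions are the double \<open>Q + Q * l\<close> for any nonzero
  \<open>l\<close> orthogonal to \<open>Q\<close> (\<open>two_elements_quaternion\<close>).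

  The root \<open>lam\<close> is the only one exactly when \<open>nu\<close> has the trace and norm of
  \<open>lam\<close>, and \<open>nu = conj lam\<close> only happens for scalar \<open>lam\<close>
  (\<open>sole_root_necessary\<close>, \<open>sole_root_sufficient\<close>). The conjugate polynomial is
  \<open>(x - conj lam) * (x - conj nu)\<close>, and the criterion is symmetric under replacing
  \<open>(nu, lam)\<close> by \<open>(conj lam, conj nu)\<close>. So \<open>mu = conj nu\<close> is its unique root; having
  the trace and norm of \<open>lam\<close>, it is conjugate to \<open>lam\<close>.

  Inside \<open>Q\<close>, besides \<open>lam ^ k\<close>, the recurrence has a solution
  \<open>(s + k t) * lam ^ k\<close> as soon as \<open>t\<close> commutes with \<open>lam\<close> and
  \<open>e = (s * lam - lam * s) + t * lam\<close> satisfies \<open>e * lam = nu * e\<close>. Such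
  \<open>s\<close>, \<open>t\<close> with \<open>e \<noteq> 0\<close> are given by \<open>jordan_data\<close>, and then all initial
  values are attained (\<open>left_recurrence_solution\<close>). Write \<open>a k = u k + v k * l\<close> with
  \<open>u k\<close>, \<open>v k\<close> in \<open>Q\<close>. Since \<open>q * (r * l) = (r * q) * l\<close>, the sequence
  \<open>u\<close> satisfies the recurrence in \<open>Q\<close>, while \<open>v\<close> satisfies the corresponding right
  recurrence; its conjugate is a left recurrence of the same kind for the conjugate polynomial
  (\<open>right_recurrence_solution\<close>). This gives the powers of \<open>conj mu = nu\<close>.\<close>

section \<open>Nonassociative unital algebras and quaternion coordinates\<close>

context unital_algebra
begin

lemma mult_zero_left_alg [simp]: "0 * (x::'o) = 0"
  using mult_add_left[of 0 0 x] by simp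

lemma mult_zero_right_alg [simp]: "(x::'o) * 0 = 0"
  using mult_add_right[of x 0 0] by simp

lemma mult_minus_left_alg [simp]: "(- (x::'o)) * y = - (x * y)"
  using mult_add_left[of "- x" x y] by (simp add: eq_neg_iff_add_eq_0)

lemma mult_minus_right_alg [simp]: "(x::'o) * (- y) = - (x * y)"
  using mult_add_right[of x "- y" y] by (simp add: eq_neg_iff_add_eq_0)

lemma mult_diff_left: "((x::'o) - y) * z = x * z - y * z"
  using mult_add_left[of x "- y" z] by simp

lemma mult_diff_right: "(x::'o) * (y - z) = x * y - x * z"
  using mult_add_right[of x y "- z"] by simp

lemma scale_one_mult [simp]: "(c *s 1) * x = c *s x" "x * (c *s 1) = c *s x"
  by (simp_all add: mult_scale_left mult_scale_right mult_one_left mult_one_right)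

lemmas alg_simps = mult_add_left mult_add_right mult_diff_left mult_diff_right
  mult_scale_left mult_scale_right mult_one_left mult_one_right

lemmas scale_simps = scale_right_distrib scale_left_distrib scale_right_diff_distrib
  scale_left_diff_distrib

text \<open>The quaternion with coordinates \<open>w, x, y, z\<close> in the basis \<open>1, i, j, i * j\<close>.\<close>

definition quat :: "'o \<Rightarrow> 'o \<Rightarrow> 'f \<Rightarrow> 'f \<Rightarrow> 'f \<Rightarrow> 'f \<Rightarrow> 'o" where
  "quat i j w x y z = w *s 1 + x *s i + y *s j + z *s (i * j)"

text \<open>Coordinate formula for the product. Associativity is not assumed; the full multiplication
  table of the basis is, so that the lemma can also be used to prove associativity.\<close>

lemma quat_mult:
  assumes "i * i = \<alpha> *s 1" "j * j = \<beta> *s 1" "j * i = - (i * j)"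
    "i * (i * j) = \<alpha> *s j" "(i * j) * i = - (\<alpha> *s j)" "j * (i * j) = - (\<beta> *s i)"
    "(i * j) * j = \<beta> *s i" "(i * j) * (i * j) = - ((\<alpha> * \<beta>) *s 1)"
  shows "quat i j w x y z * quat i j w' x' y' z' =
    quat i j (w * w' + \<alpha> * x * x' + \<beta> * y * y' - \<alpha> * \<beta> * z * z')
      (w * x' + x * w' - \<beta> * y * z' + \<beta> * z * y')
      (w * y' + y * w' + \<alpha> * x * z' - \<alpha> * z * x')
      (w * z' + z * w' + x * y' - y * x')"
  unfolding quat_def
  by (simp add: alg_simps assms scale_simps algebra_simps)

lemma span_quat: "span {1, i, j, i * j} = range (\<lambda>(w, x, y, z). quat i j w x y z)"
proof
  show "span {1, i, j, i * j} \<subseteq> range (\<lambda>(w, x, y, z). quat i j w x y z)"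
  proof
    fix x assume "x \<in> span {1, i, j, i * j}"
    then obtain a b c d where "x - a *s 1 - b *s i - c *s j - d *s (i * j) = 0"
      by (auto simp: span_breakdown_eq)
    then have "x = quat i j a b c d" by (simp add: quat_def algebra_simps)
    then show "x \<in> range (\<lambda>(w, x, y, z). quat i j w x y z)"
      by (intro range_eqI[of _ _ "(a, b, c, d)"]) simp
  qed
next
  show "range (\<lambda>(w, x, y, z). quat i j w x y z) \<subseteq> span {1, i, j, i * j}"
    unfolding quat_def by (auto intro!: span_add span_scale intro: span_base)
qed

end

section \<open>The doubling presentation\<close>

context unital_algebra
begin

lemma quaternion_generators_table:
  assumes "quaternion_generators A i j"
  obtains \<alpha> \<beta> where "i * i = \<alpha> *s 1" "j * j = \<beta> *s 1" "j * i = - (i * j)"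
    "i * (i * j) = \<alpha> *s j" "(i * j) * i = - (\<alpha> *s j)" "j * (i * j) = - (\<beta> *s i)"
    "(i * j) * j = \<beta> *s i" "(i * j) * (i * j) = - ((\<alpha> * \<beta>) *s 1)"
proof -
  obtain \<alpha> \<beta> where t: "i * i = \<alpha> *s 1" "j * j = \<beta> *s 1" "j * i = - (i * j)"
    using assms unfolding quaternion_generators_def by (elim exE conjE)
  have sp: "span {1, i, j, i * j} = A" and sub: "subalgebra A"
    and as: "\<And>x y z. x \<in> A \<Longrightarrow> y \<in> A \<Longrightarrow> z \<in> A \<Longrightarrow> (x * y) * z = x * (y * z)"
    using assms unfolding quaternion_generators_def by simp_all
  have A: "i \<in> A" "j \<in> A" unfolding sp[symmetric] by (simp_all add: span_base)
  have cl: "x * y \<in> A" if "x \<in> A" "y \<in> A" for x y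
    using sub that unfolding subalgebra_def by simp
  have 1: "i * (i * j) = \<alpha> *s j" by (simp only: as[symmetric] A t scale_one_mult)
  have 2: "(i * j) * j = \<beta> *s i" by (simp only: as A t scale_one_mult)
  have 3: "(i * j) * i = - (\<alpha> *s j)" by (simp only: as A t 1 mult_minus_right_alg)
  have 4: "j * (i * j) = - (\<beta> *s i)"
    by (simp only: as[symmetric] A t mult_minus_left_alg 2)
  have 5: "(i * j) * (i * j) = - ((\<alpha> * \<beta>) *s 1)"
    by (simp only: as A cl 4 mult_minus_right_alg mult_scale_right t) (simp add: mult.commute)
  show thesis by (rule that[OF t 1 3 4 2 5])
qed

end

context octonion_algebra
begin

text \<open>Everything the sequel uses about the doubling presentation: the involution is an
  anti-automorphism; \<open>x * conj x\<close> is a scalar; multiplying by \<open>x\<close> and then by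
  \<open>conj x\<close> from the left is multiplication by that scalar (a form of the left alternative law);
  and the eight basis elements of the double span the algebra.\<close>

lemma doubling_facts:
  obtains A i j l where
    "\<And>x y. conj (x + y) = conj x + conj y" "\<And>c x. conj (c *s x) = c *s conj x"
    "\<And>x. conj (conj x) = x" "\<And>x y. conj (x * y) = conj y * conj x"
    "\<And>x. \<exists>c. x * conj x = c *s 1 \<and> (\<forall>y. conj x * (x * y) = c *s y)"
    "conj 1 = 1" "conj i = - i" "conj j = - j" "conj l = - l" "l \<noteq> 0"
    "quaternion_generators A i j" "\<forall>q\<in>A. q * l = l * conj q"
    "span ({1, i, j, i * j} \<union> (\<lambda>q. q * l) ` {1, i, j, i * j}) = UNIV"
proof -
  obtain A \<gamma> l where inv: "standard_involution A conj"
    and cd: "cayley_dickson_double conj A \<gamma> l"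
    and conjl: "\<forall>q\<in>A. \<forall>r\<in>A. conj (q + r * l) = conj q - r * l"
    using doubling by blast
  obtain i j where gen: "quaternion_generators A i j"
    and "\<forall>w x y z. conj (w *s 1 + x *s i + y *s j + z *s (i * j)) =
                   w *s 1 - x *s i - y *s j - z *s (i * j)"
    using inv unfolding standard_involution_def by (elim exE conjE)
  then have conjq: "conj (quat i j w x y z) = quat i j w (- x) (- y) (- z)" for w x y z
    by (simp add: quat_def)
  obtain \<alpha> \<beta> where tab: "i * i = \<alpha> *s 1" "j * j = \<beta> *s 1" "j * i = - (i * j)"
    "i * (i * j) = \<alpha> *s j" "(i * j) * i = - (\<alpha> *s j)" "j * (i * j) = - (\<beta> *s i)"
    "(i * j) * j = \<beta> *s i" "(i * j) * (i * j) = - ((\<alpha> * \<beta>) *s 1)"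
    by (rule quaternion_generators_table[OF gen])
  note qm = quat_mult[OF tab]
  have subA: "subalgebra A"
    and as: "\<And>x y z. x \<in> A \<Longrightarrow> y \<in> A \<Longrightarrow> z \<in> A \<Longrightarrow> (x * y) * z = x * (y * z)"
    and sp: "span {1, i, j, i * j} = A"
    using gen unfolding quaternion_generators_def by simp_all
  have sub: "subspace A" and oneA: "1 \<in> A" and mA: "\<And>x y. x \<in> A \<Longrightarrow> y \<in> A \<Longrightarrow> x * y \<in> A"
    using subA unfolding subalgebra_def by simp_all
  have rA: "A = range (\<lambda>(w, x, y, z). quat i j w x y z)" using sp span_quat[of i j] by simp
  have Aq: "\<exists>w x y z. q = quat i j w x y z" if "q \<in> A" for q
    using that unfolding rA by auto
  have qA: "quat i j w x y z \<in> A" for w x y z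
    unfolding rA by (rule range_eqI[of _ _ "(w, x, y, z)"]) simp
  have addA: "x + y \<in> A" if "x \<in> A" "y \<in> A" for x y using subspace_add[OF sub that] .
  have scA: "c *s x \<in> A" if "x \<in> A" for c x using subspace_scale[OF sub that] .
  have diffA: "x - y \<in> A" if "x \<in> A" "y \<in> A" for x y using subspace_diff[OF sub that] .
  have zA: "0 \<in> A" using subspace_0[OF sub] .
  have negA: "- x \<in> A" if "x \<in> A" for x using subspace_neg[OF sub that] .
  have cA: "conj q \<in> A" if "q \<in> A" for q using Aq[OF that] conjq qA by metis
  have ccA: "conj (conj q) = q" if "q \<in> A" for q using Aq[OF that] by (auto simp: conjq)
  have qadd: "quat i j w x y z + quat i j w' x' y' z' = quat i j (w+w') (x+x') (y+y') (z+z')"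
    for w x y z w' x' y' z' by (simp add: quat_def scale_simps algebra_simps)
  have qsc: "c *s quat i j w x y z = quat i j (c * w) (c * x) (c * y) (c * z)"
    for c w x y z by (simp add: quat_def scale_simps algebra_simps)
  have cadd: "conj (q + r) = conj q + conj r" if "q \<in> A" "r \<in> A" for q r
    using Aq[OF that(1)] Aq[OF that(2)] by (auto simp: conjq qadd algebra_simps)
  have csc: "conj (c *s q) = c *s conj q" if "q \<in> A" for q c
    using Aq[OF that(1)] by (auto simp: conjq qsc algebra_simps)
  have cm: "conj (q * r) = conj r * conj q" if "q \<in> A" "r \<in> A" for q r
    using Aq[OF that(1)] Aq[OF that(2)] by (auto simp: conjq qm algebra_simps)
  have norm: "\<exists>c. q * conj q = c *s 1 \<and> conj q * q = c *s 1" if "q \<in> A" for q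
  proof -
    from Aq[OF that] obtain w x y z where q: "q = quat i j w x y z" by blast
    have e: "c *s 1 = quat i j c 0 0 0" for c by (simp add: quat_def)
    show ?thesis unfolding q e
      by (rule exI[of _ "w * w - \<alpha> * x * x - \<beta> * y * y + \<alpha> * \<beta> * z * z"])
        (simp add: conjq qm algebra_simps)
  qed
  have g0: "\<gamma> \<noteq> 0" and dd: "direct_double A l"
    and prod: "\<And>q r s t. q \<in> A \<Longrightarrow> r \<in> A \<Longrightarrow> s \<in> A \<Longrightarrow> t \<in> A \<Longrightarrow>
        (q + r * l) * (s + t * l) = (q * s + \<gamma> *s (conj t * r)) + (t * q + r * conj s) * l"
    using cd unfolding cayley_dickson_double_def by simp_all
  have ex: "\<exists>q r. q \<in> A \<and> r \<in> A \<and> x = q + r * l" for x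
  proof -
    have "\<exists>!(q, r). q \<in> A \<and> r \<in> A \<and> x = q + r * l"
      using dd unfolding direct_double_def by (rule spec)
    then show ?thesis by (auto elim!: ex1E)
  qed
  have conjl': "\<And>q r. q \<in> A \<Longrightarrow> r \<in> A \<Longrightarrow> conj (q + r * l) = conj q - r * l" using conjl by simp
  have neg: "conj (- q) = - conj q" if "q \<in> A" for q
    using csc[OF that, of "-1"] by simp
  note clo = addA scA diffA zA negA cA mA oneA
  have conjl2: "\<And>q r. q \<in> A \<Longrightarrow> r \<in> A \<Longrightarrow> conj (q + r * l) = conj q + (- r) * l"
    by (simp add: conjl')
  have 1: "conj (x + y) = conj x + conj y" for x y
  proof -
    obtain q r s t where x: "q \<in> A" "r \<in> A" "x = q + r * l" and y: "s \<in> A" "t \<in> A" "y = s + t * l"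
      using ex by meson
    have e: "x + y = (q + s) + (r + t) * l" using x y by (simp add: alg_simps)
    have "conj (x + y) = conj (q + s) - (r + t) * l"
      unfolding e using x y by (intro conjl' clo)
    then show ?thesis using x y by (simp add: conjl' cadd alg_simps)
  qed
  have 2: "conj (c *s x) = c *s conj x" for c x
  proof -
    obtain q r where x: "q \<in> A" "r \<in> A" "x = q + r * l"
      using ex by meson
    have e: "c *s x = c *s q + (c *s r) * l" using x by (simp add: alg_simps scale_simps)
    have "conj (c *s x) = conj (c *s q) - (c *s r) * l"
      unfolding e using x by (intro conjl' clo)
    then show ?thesis using x by (simp add: conjl' csc alg_simps scale_simps)
  qed
  have 3: "conj (conj x) = x" for x
  proof -
    obtain q r where x: "q \<in> A" "r \<in> A" "x = q + r * l"
      using ex by meson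
    have "conj x = conj q + (- r) * l" using x by (simp add: conjl2)
    then show ?thesis using x by (simp only: conjl2 clo ccA) simp
  qed
  have 4: "conj (x * y) = conj y * conj x" for x y
  proof -
    obtain q r s t where x: "q \<in> A" "r \<in> A" "x = q + r * l" and y: "s \<in> A" "t \<in> A" "y = s + t * l"
      using ex by meson
    have "conj y * conj x = (conj s + (- t) * l) * (conj q + (- r) * l)"
      using x y by (simp only: conjl2)
    also have "\<dots> = (conj s * conj q + \<gamma> *s (conj (- r) * (- t))) + ((- r) * conj s + (- t) * conj (conj q)) * l"
      using x y by (intro prod clo)
    finally have a: "conj y * conj x = (conj s * conj q + \<gamma> *s (conj r * t)) - (r * conj s + t * q) * l"
      using x y by (simp add: neg ccA algebra_simps alg_simps)
    have "conj (x * y) = conj (q * s + \<gamma> *s (conj t * r)) - (t * q + r * conj s) * l"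
      using x y by (simp only: prod) (intro conjl' clo)
    also have "\<dots> = (conj s * conj q + \<gamma> *s (conj r * t)) - (t * q + r * conj s) * l"
      using x y by (simp add: cadd csc cm ccA clo)
    finally show ?thesis using a by (simp add: add.commute)
  qed
  have 5: "\<exists>c. x * conj x = c *s 1 \<and> (\<forall>y. conj x * (x * y) = c *s y)" for x
  proof -
    obtain q r where x: "q \<in> A" "r \<in> A" "x = q + r * l"
      using ex by meson
    obtain m n where m: "q * conj q = m *s 1" "conj q * q = m *s 1"
      and n: "r * conj r = n *s 1" "conj r * r = n *s 1" using norm x by meson
    have cx: "conj x = conj q + (- r) * l" using x by (simp only: conjl2)
    have "x * conj x = (q * conj q + \<gamma> *s (conj (- r) * r)) + (- r * q + r * conj (conj q)) * l"
      unfolding cx using x by (simp only: prod clo)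
    also have "\<dots> = (m - \<gamma> * n) *s 1" using x by (simp add: ccA neg m n scale_simps)
    finally have a: "x * conj x = (m - \<gamma> * n) *s 1" .
    have "conj x * (x * y) = (m - \<gamma> * n) *s y" for y
    proof -
      obtain s t where y: "s \<in> A" "t \<in> A" "y = s + t * l" using ex by meson
      have "conj x * (x * y) = (conj q + (- r) * l) * ((q * s + \<gamma> *s (conj t * r)) + (t * q + r * conj s) * l)"
        unfolding cx using x y by (simp only: prod)
      also have "\<dots> = (conj q * (q * s + \<gamma> *s (conj t * r)) + \<gamma> *s (conj (t * q + r * conj s) * (- r)))
         + ((t * q + r * conj s) * conj q + (- r) * conj (q * s + \<gamma> *s (conj t * r))) * l"
        using x y by (simp only: prod clo)
      also have "conj q * (q * s + \<gamma> *s (conj t * r)) = m *s s + \<gamma> *s (conj q * (conj t * r))"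
        using x y by (simp add: alg_simps as[symmetric] m clo)
      also have "conj (t * q + r * conj s) * (- r) = - (conj q * (conj t * r)) - n *s s"
        using x y by (simp add: cadd cm ccA clo alg_simps as n)
      also have "(t * q + r * conj s) * conj q = m *s t + r * (conj s * conj q)"
        using x y by (simp add: alg_simps as m clo)
      also have "(- r) * conj (q * s + \<gamma> *s (conj t * r)) = - (r * (conj s * conj q)) - \<gamma> *s n *s t"
        using x y by (simp add: cadd csc cm ccA clo alg_simps as[symmetric] n)
      finally show ?thesis by (simp add: y alg_simps scale_simps algebra_simps)
    qed
    then show ?thesis using a by blast
  qed
  have c1: "conj 1 = 1" using conjq[of 1 0 0 0] by (simp add: quat_def)
  have ci: "conj i = - i" using conjq[of 0 1 0 0] by (simp add: quat_def)
  have cj: "conj j = - j" using conjq[of 0 0 1 0] by (simp add: quat_def)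
  have l0: "l \<noteq> 0"
  proof
    assume "l = 0"
    moreover have "\<exists>!(q, r). q \<in> A \<and> r \<in> A \<and> 0 = q + r * l"
      using dd unfolding direct_double_def by (rule spec)
    ultimately have "(0::'o, 0::'o) = (0, 1)"
      by (elim ex1E) (metis (mono_tags, lifting) case_prod_conv zA oneA mult_zero_right_alg add_0)
    then have "(1::'o) = 0" by simp
    moreover have "independent {1, i, j, i * j}"
      using gen unfolding quaternion_generators_def by simp
    ultimately show False using dependent_zero[of "{1, i, j, i * j}"] by simp
  qed
  have c0: "conj 0 = 0" using 2[of 0 0] by simp
  have cl: "conj l = - l" using conjl'[of 0 1] clo c0 by (simp add: mult_one_left)
  have ql: "q * l = l * conj q" if "q \<in> A" for q
    using prod[of 0 1 "conj q" 0] that clo c0 ccA by (simp add: alg_simps)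
  have "UNIV \<subseteq> span ({1, i, j, i * j} \<union> (\<lambda>q. q * l) ` {1, i, j, i * j})" (is "_ \<subseteq> span ?S")
  proof
    fix x
    obtain q r where x: "q \<in> A" "r \<in> A" "x = q + r * l" using ex by meson
    have "q \<in> span ?S"
      using x(1) sp span_mono[of "{1, i, j, i * j}" ?S, OF Un_upper1] by (simp only: subset_iff)
    moreover from Aq[OF x(2)] obtain a b c d where r: "r = quat i j a b c d" by blast
    have "r * l \<in> span ?S" unfolding r quat_def
      by (simp only: mult_add_left mult_scale_left) (intro span_add span_scale span_base; simp)
    ultimately show "x \<in> span ?S" unfolding x(3) by (rule span_add)
  qed
  then have "span ({1, i, j, i * j} \<union> (\<lambda>q. q * l) ` {1, i, j, i * j}) = UNIV" by blast
  moreover have "\<forall>q\<in>A. q * l = l * conj q" using ql by simp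
  ultimately show thesis by (intro that[OF 1 2 3 4 5 c1 ci cj cl l0 gen])
qed

end

section \<open>Norm, trace and alternative laws\<close>

context octonion_algebra
begin

lemma conj_add: "conj (x + y) = conj x + conj y"
  by (rule doubling_facts)

lemma conj_scale: "conj (c *s x) = c *s conj x"
  by (rule doubling_facts)

lemma conj_conj [simp]: "conj (conj x) = x"
  by (rule doubling_facts)

lemma conj_mult: "conj (x * y) = conj y * conj x"
  by (rule doubling_facts)

lemma conj_one [simp]: "conj 1 = 1"
  by (rule doubling_facts)

lemma conj_zero [simp]: "conj 0 = 0"
  using conj_scale[of 0 0] by simp

lemma conj_minus: "conj (- x) = - conj x"
  using conj_scale[of "- 1" x] by simp

lemma conj_diff: "conj (x - y) = conj x - conj y"
  using conj_add[of x "- y"] by (simp add: conj_minus)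

lemmas conj_simps = conj_add conj_scale conj_mult conj_minus conj_diff

lemma one_neq_zero [simp]: "(1::'o) \<noteq> 0"
proof (rule doubling_facts)
  fix A i j
  assume "quaternion_generators A i j"
  then have "independent {1, i, j, i * j}" unfolding quaternion_generators_def by simp
  then show "(1::'o) \<noteq> 0" using dependent_zero by fastforce
qed

lemma zero_neq_one_alg [simp]: "(0::'o) \<noteq> 1"
  by (rule not_sym[OF one_neq_zero])

lemma scale_one_eq_iff [simp]: "a *s (1::'o) = b *s 1 \<longleftrightarrow> a = b"
  by (simp add: scale_cancel_right)

lemma scale_one_eq_0_iff [simp]: "a *s (1::'o) = 0 \<longleftrightarrow> a = 0"
  by simp

text \<open>The norm form, its polar form and the trace, with values in the base field rather than in
  its copy \<open>F *s 1\<close> inside the algebra. In particular \<open>bil x x\<close> is twice the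
  norm of \<open>x\<close>.\<close>

definition nrm :: "'o \<Rightarrow> 'f" where
  "nrm x = (THE c. x * conj x = c *s 1)"

definition bil :: "'o \<Rightarrow> 'o \<Rightarrow> 'f" where
  "bil x y = nrm (x + y) - nrm x - nrm y"

definition tr :: "'o \<Rightarrow> 'f" where
  "tr x = bil x 1"

lemma nrm_ex: "\<exists>c. x * conj x = c *s 1 \<and> (\<forall>y. conj x * (x * y) = c *s y)"
  by (rule doubling_facts)

lemma nrm_eq: "x * conj x = c *s 1 \<Longrightarrow> nrm x = c"
  unfolding nrm_def by (rule the_equality) auto

lemma conj_mult_cancel_left: "conj x * (x * y) = nrm x *s y"
  using nrm_ex[of x] nrm_eq[of x] by auto

lemma mult_conj: "x * conj x = nrm x *s 1"
  using nrm_ex[of x] nrm_eq[of x] by auto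

lemma conj_mult_self: "conj x * x = nrm x *s 1"
  using conj_mult_cancel_left[of x 1] by (simp add: mult_one_right)

lemma nrm_conj [simp]: "nrm (conj x) = nrm x"
  by (rule nrm_eq) (simp add: conj_mult_self)

lemma mult_conj_cancel_left: "x * (conj x * y) = nrm x *s y"
  using conj_mult_cancel_left[of "conj x" y] by simp

lemma mult_conj_cancel_right: "(y * x) * conj x = nrm x *s y"
proof -
  have "conj (x * (conj x * conj y)) = conj (nrm x *s conj y)"
    by (simp only: mult_conj_cancel_left)
  then show ?thesis by (simp add: conj_simps)
qed

lemma conj_mult_cancel_right: "(y * conj x) * x = nrm x *s y"
  using mult_conj_cancel_right[of y "conj x"] by simp

lemma mult_conj_polar: "x * conj y + y * conj x = bil x y *s 1"
proof -
  have "(x + y) * conj (x + y) = nrm (x + y) *s 1" by (rule mult_conj)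
  then show ?thesis
    by (simp add: bil_def alg_simps conj_simps mult_conj scale_simps algebra_simps)
qed

text \<open>The linearised alternative laws, which serve as a substitute for associativity.\<close>

lemma polar_left: "conj x * (z * y) + conj z * (x * y) = bil x z *s y"
proof -
  have "conj (x + z) * ((x + z) * y) = nrm (x + z) *s y" by (rule conj_mult_cancel_left)
  then show ?thesis
    by (simp add: bil_def alg_simps conj_simps conj_mult_cancel_left scale_simps algebra_simps)
qed

lemma polar_right: "(y * x) * conj z + (y * z) * conj x = bil x z *s y"
proof -
  have "(y * (x + z)) * conj (x + z) = nrm (x + z) *s y" by (rule mult_conj_cancel_right)
  then show ?thesis
    by (simp add: bil_def alg_simps conj_simps mult_conj_cancel_right scale_simps algebra_simps)
qed

lemma conj_mult_polar: "conj x * z + conj z * x = bil x z *s 1"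
  using polar_left[of x z 1] by (simp add: mult_one_right)

lemma add_conj: "x + conj x = tr x *s 1"
  using mult_conj_polar[of x 1] by (simp add: tr_def alg_simps)

lemma conj_eq: "conj x = tr x *s 1 - x"
  using add_conj[of x] by (simp add: algebra_simps)

lemma bil_commute: "bil x y = bil y x"
  by (simp add: bil_def add.commute algebra_simps)

lemma bil_add_left: "bil (x + y) z = bil x z + bil y z"
proof -
  have "bil (x + y) z *s (1::'o) = (bil x z + bil y z) *s 1"
    unfolding scale_left_distrib mult_conj_polar[symmetric] by (simp add: alg_simps conj_simps algebra_simps)
  then show ?thesis by simp
qed

lemma bil_scale_left: "bil (c *s x) z = c * bil x z"
proof -
  have "bil (c *s x) z *s (1::'o) = (c * bil x z) *s 1"
    unfolding scale_scale[symmetric] mult_conj_polar[symmetric]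
    by (simp add: alg_simps conj_simps scale_simps)
  then show ?thesis by simp
qed

lemma bil_add_right: "bil z (x + y) = bil z x + bil z y"
  by (simp add: bil_commute[of z] bil_add_left)

lemma bil_scale_right: "bil z (c *s x) = c * bil z x"
  by (simp add: bil_commute[of z] bil_scale_left)

lemma bil_zero [simp]: "bil 0 x = 0" "bil x 0 = 0"
  using bil_scale_left[of 0 0 x] bil_scale_right[of x 0 0] by simp_all

lemma bil_minus: "bil (- x) z = - bil x z" "bil z (- x) = - bil z x"
  using bil_scale_left[of "- 1" x z] bil_scale_right[of z "- 1" x] by simp_all

lemma bil_diff: "bil (x - y) z = bil x z - bil y z" "bil z (x - y) = bil z x - bil z y"
  using bil_add_left[of x "- y" z] bil_add_right[of z x "- y"] by (simp_all add: bil_minus)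

lemmas bil_simps = bil_add_left bil_add_right bil_scale_left bil_scale_right bil_minus bil_diff

lemma bil_sum_left: "bil (\<Sum>x\<in>S. f x) z = (\<Sum>x\<in>S. bil (f x) z)"
  by (induction S rule: infinite_finite_induct) (simp_all add: bil_add_left)

lemma nrm_scale: "nrm (c *s x) = c * c * nrm x"
  by (rule nrm_eq) (simp add: conj_scale alg_simps mult_conj mult.assoc)

lemma nrm_minus [simp]: "nrm (- x) = nrm x"
  using nrm_scale[of "- 1" x] by simp

lemma nrm_zero [simp]: "nrm 0 = 0"
  by (rule nrm_eq) simp

lemma nrm_one [simp]: "nrm 1 = 1"
  by (rule nrm_eq) (simp add: mult_one_left)

lemma nrm_add: "nrm (x + y) = nrm x + nrm y + bil x y"
  by (simp add: bil_def)

lemma bil_self: "bil x x = 2 * nrm x"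
proof -
  have "bil x x *s (1::'o) = (nrm x + nrm x) *s 1"
    unfolding mult_conj_polar[symmetric] mult_conj by (simp only: scale_left_distrib)
  then have "bil x x = nrm x + nrm x" by (simp only: scale_one_eq_iff)
  then show ?thesis by simp
qed

lemma tr_add: "tr (x + y) = tr x + tr y"
  and tr_diff: "tr (x - y) = tr x - tr y"
  and tr_minus: "tr (- x) = - tr x"
  and tr_scale: "tr (c *s x) = c * tr x"
  by (simp_all add: tr_def bil_simps)

lemma tr_one: "tr 1 = 2"
  by (simp add: tr_def bil_self)

lemmas tr_simps = tr_add tr_diff tr_minus tr_scale tr_one

lemma tr_conj [simp]: "tr (conj x) = tr x"
  by (simp add: conj_eq[of x] tr_simps)

lemma square_eq: "x * x = tr x *s x - nrm x *s 1"
  using mult_conj[of x] by (simp add: conj_eq alg_simps algebra_simps)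

lemma nrm_mult: "nrm (x * y) = nrm x * nrm y"
proof (cases "x = 0")
  case False
  have "nrm (x * y) *s conj x = (conj x * (x * y)) * conj (x * y)"
    by (rule mult_conj_cancel_right[symmetric])
  also have "\<dots> = nrm x *s (y * (conj y * conj x))"
    by (simp add: conj_mult_cancel_left conj_mult alg_simps)
  also have "\<dots> = (nrm x * nrm y) *s conj x"
    by (simp add: mult_conj_cancel_left)
  finally show ?thesis
    using False conj_conj[of x] conj_zero by (metis scale_right_imp_eq)
qed simp

lemma bil_mult_right: "bil (x * z) (y * z) = nrm z * bil x y"
  using nrm_mult[of "x + y" z] by (simp add: alg_simps bil_def nrm_mult algebra_simps)

lemma bil_mult_left: "bil (z * x) (z * y) = nrm z * bil x y"
  using nrm_mult[of z "x + y"] by (simp add: alg_simps bil_def nrm_mult algebra_simps)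

text \<open>Left multiplication by \<open>conj r\<close> is the adjoint of left multiplication by \<open>r\<close>.\<close>

lemma bil_adjoint: "bil q (r * l) = bil (conj r * q) l"
proof -
  have 1: "bil r 1 = tr r" "bil 1 r = tr r" by (simp_all add: tr_def bil_commute)
  have "bil ((r + 1) * l) ((r + 1) * q) = nrm (r + 1) * bil l q" by (rule bil_mult_left)
  then have 2: "bil (r * l) q + bil l (r * q) = tr r * bil l q"
    by (simp add: alg_simps bil_add_left bil_add_right bil_mult_left nrm_add 1 algebra_simps)
  have "bil q (r * l) = bil (r * l) q" by (rule bil_commute)
  also have "\<dots> = bil l (tr r *s q - r * q)"
    using 2 by (simp add: bil_simps algebra_simps)
  also have "\<dots> = bil (conj r * q) l"
    by (simp add: conj_eq mult_diff_left bil_commute[of l])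
  finally show ?thesis .
qed

end

section \<open>Orthogonal bases and quaternion subalgebras\<close>

text \<open>The norm of a division algebra is anisotropic, and 2 is invertible.\<close>

locale octonion_division_algebra_char_0 = octonion_division_algebra scale conj
  for scale :: "'f::field_char_0 \<Rightarrow> 'o::{ab_group_add, power} \<Rightarrow> 'o" (infixr "*s" 75)
    and conj :: "'o \<Rightarrow> 'o"
begin

lemma nrm_eq_0_iff [simp]: "nrm x = 0 \<longleftrightarrow> x = 0"
proof
  assume n: "nrm x = 0"
  show "x = 0"
  proof (rule ccontr)
    assume "x \<noteq> 0"
    then have "\<exists>!z. x * z = 0" by (rule left_division)
    moreover have "x * conj x = 0" "x * 0 = 0" using n by (simp_all add: mult_conj)
    ultimately have "conj x = 0" by blast
    then show False using \<open>x \<noteq> 0\<close> conj_conj[of x] by simp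
  qed
qed simp

lemma mult_eq_0_iff_alg [simp]: "(x::'o) * y = 0 \<longleftrightarrow> x = 0 \<or> y = 0"
  using nrm_mult[of x y] nrm_eq_0_iff by (metis mult_eq_0_iff)

text \<open>Finite sets of pairwise orthogonal nonzero vectors for the polar form. As the norm is
  anisotropic, no member is isotropic.\<close>

definition orthogonal :: "'o set \<Rightarrow> bool" where
  "orthogonal S \<longleftrightarrow> finite S \<and> 0 \<notin> S \<and> (\<forall>x\<in>S. \<forall>y\<in>S. x \<noteq> y \<longrightarrow> bil x y = 0)"

lemma orthogonal_independent:
  assumes "orthogonal S"
  shows "independent S"
proof (rule independent_if_scalars_zero)
  show fin: "finite S" using assms unfolding orthogonal_def by blast
  fix f x
  assume s: "(\<Sum>x\<in>S. f x *s x) = 0" and x: "x \<in> S"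
  have "0 = bil (\<Sum>y\<in>S. f y *s y) x" using s by simp
  also have "\<dots> = (\<Sum>y\<in>S. f y * bil y x)" by (simp add: bil_sum_left bil_scale_left)
  also have "\<dots> = (\<Sum>y\<in>S. if y = x then f x * bil x x else 0)"
    using assms x by (intro sum.cong) (auto simp: orthogonal_def)
  also have "\<dots> = f x * bil x x" using fin x by simp
  finally have "f x * (2 * nrm x) = 0" by (simp add: bil_self)
  moreover have "x \<noteq> 0" using assms x unfolding orthogonal_def by blast
  ultimately show "f x = 0" by simp
qed

text \<open>The Cayley--Dickson step on orthogonal bases. Starting from \<open>{1}\<close> it produces the basis
  of a quadratic, then of a quaternion subalgebra, and finally of the whole algebra.\<close>

lemma orthogonal_double:
  assumes S: "orthogonal S" and l: "l \<noteq> 0"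
    and perp: "\<And>q r. q \<in> S \<Longrightarrow> r \<in> S \<Longrightarrow> bil (conj r * q) l = 0"
  shows "orthogonal (S \<union> (\<lambda>q. q * l) ` S)" "card (S \<union> (\<lambda>q. q * l) ` S) = 2 * card S"
proof -
  have fin: "finite S" and n0: "\<And>x. x \<in> S \<Longrightarrow> x \<noteq> 0"
    and o: "\<And>x y. x \<in> S \<Longrightarrow> y \<in> S \<Longrightarrow> x \<noteq> y \<Longrightarrow> bil x y = 0"
    using S unfolding orthogonal_def by blast+
  have p: "bil q (r * l) = 0" if "q \<in> S" "r \<in> S" for q r
    using perp[OF that] by (simp add: bil_adjoint)
  have p': "bil (r * l) q = 0" if "q \<in> S" "r \<in> S" for q r
    using p[OF that] bil_commute by simp
  have pp: "bil (q * l) (r * l) = 0" if "q \<in> S" "r \<in> S" "q * l \<noteq> r * l" for q r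
    using o[OF that(1,2)] that(3) by (auto simp: bil_mult_right)
  show "orthogonal (S \<union> (\<lambda>q. q * l) ` S)"
    unfolding orthogonal_def
  proof (intro conjI ballI impI)
    show "finite (S \<union> (\<lambda>q. q * l) ` S)" using fin by simp
    show "0 \<notin> S \<union> (\<lambda>q. q * l) ` S" using n0 l by auto
    fix x y
    assume "x \<in> S \<union> (\<lambda>q. q * l) ` S" "y \<in> S \<union> (\<lambda>q. q * l) ` S" "x \<noteq> y"
    then show "bil x y = 0"
      by (elim UnE imageE) (simp_all add: p p' pp o)
  qed
  have "inj_on (\<lambda>q. q * l) S"
  proof (rule inj_onI)
    fix x y assume "x * l = y * l"
    then have "(x - y) * l = 0" by (simp add: mult_diff_left)
    then show "x = y" using l by simp
  qed
  moreover have "S \<inter> (\<lambda>q. q * l) ` S = {}"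
  proof -
    have False if "q \<in> S" "r \<in> S" "q = r * l" for q r
      using p[OF that(1,2)] that n0 bil_self[of q] by auto
    then show ?thesis by blast
  qed
  ultimately show "card (S \<union> (\<lambda>q. q * l) ` S) = 2 * card S"
    using fin by (simp add: card_Un_disjoint card_image)
qed

lemma orthogonal_quaternion_basis:
  assumes "i \<noteq> 0" "j \<noteq> 0" "tr i = 0" "tr j = 0" "bil i j = 0"
  shows "orthogonal {1, i, j, i * j}" "card {1, i, j, i * j} = 4"
proof -
  have 1: "orthogonal {1}" unfolding orthogonal_def by simp
  have p: "bil (conj r * q) i = 0" if "q \<in> {1}" "r \<in> {1}" for q r
    using that assms by (simp add: mult_one_left bil_commute[of 1] tr_def)
  have 2: "orthogonal {1, i}" "card {1, i} = 2"
    using orthogonal_double[OF 1 assms(1) p] by (simp_all add: mult_one_left insert_commute)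
  have "bil (conj r * q) j = 0" if "q \<in> {1, i}" "r \<in> {1, i}" for q r
  proof -
    have "bil 1 j = 0" "conj i = - i" using assms by (simp_all add: conj_eq tr_def bil_commute)
    then show ?thesis
      using that assms by (auto simp: mult_one_left mult_one_right bil_simps square_eq)
  qed
  note d = orthogonal_double[OF 2(1) assms(2) this]
  have e: "{1, i} \<union> (\<lambda>q. q * j) ` {1, i} = {1, i, j, i * j}" by (auto simp: mult_one_left)
  show "orthogonal {1, i, j, i * j}" "card {1, i, j, i * j} = 4"
    using d 2(2) unfolding e by simp_all
qed

text \<open>Two orthogonal trace-zero vectors generate a quaternion subalgebra: the multiplication table
  follows from the alternative laws, and associativity from the coordinate formula.\<close>

lemma quaternion_generatorsI:
  assumes ij: "i \<noteq> 0" "j \<noteq> 0" "tr i = 0" "tr j = 0" "bil i j = 0"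
  shows "quaternion_generators (span {1, i, j, i * j}) i j"
proof -
  note o = orthogonal_quaternion_basis[OF ij]
  have ci: "conj i = - i" and cj: "conj j = - j" using ij by (simp_all add: conj_eq)
  have t1: "i * i = (- nrm i) *s 1" and t2: "j * j = (- nrm j) *s 1"
    using ij by (simp_all add: square_eq)
  have t3: "j * i = - (i * j)"
  proof -
    have "- (i * j) - j * i = 0" using mult_conj_polar[of i j] ij(5) by (simp add: ci cj)
    then show ?thesis by simp
  qed
  have t4: "i * (i * j) = (- nrm i) *s j"
    using arg_cong[OF conj_mult_cancel_left[of i j], of uminus] by (simp add: ci)
  have t5: "(i * j) * i = - ((- nrm i) *s j)"
    using mult_conj_cancel_right[of j i] by (simp add: ci t3)
  have t7: "(i * j) * j = (- nrm j) *s i"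
    using arg_cong[OF mult_conj_cancel_right[of i j], of uminus] by (simp add: cj)
  have t6: "j * (i * j) = - ((- nrm j) *s i)"
    using conj_mult_cancel_left[of j i] by (simp add: cj t3)
  have "1 \<noteq> i * j"
    using o(2) by (auto simp: card_insert_if split: if_splits)
  then have "tr (i * j) = 0"
    using o(1) unfolding orthogonal_def tr_def by auto
  then have t8: "(i * j) * (i * j) = - (((- nrm i) * (- nrm j)) *s 1)"
    by (simp add: square_eq nrm_mult)
  note qm = quat_mult[OF t1 t2 t3 t4 t5 t6 t7 t8]
  define Q where "Q = span {1, i, j, i * j}"
  have rQ: "Q = range (\<lambda>(w, x, y, z). quat i j w x y z)" unfolding Q_def by (rule span_quat)
  have Qq: "\<exists>w x y z. q = quat i j w x y z" if "q \<in> Q" for q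
    using that unfolding rQ by auto
  have qQ: "quat i j w x y z \<in> Q" for w x y z
    unfolding rQ by (rule range_eqI[of _ _ "(w, x, y, z)"]) simp
  have cl: "x * y \<in> Q" if "x \<in> Q" "y \<in> Q" for x y
    using Qq[OF that(1)] Qq[OF that(2)] by (auto simp: qm qQ)
  have as: "(x * y) * z = x * (y * z)" if "x \<in> Q" "y \<in> Q" "z \<in> Q" for x y z
  proof -
    have e: "quat i j w x y z = quat i j w' x' y' z'" if "w = w'" "x = x'" "y = y'" "z = z'"
      for w x y z w' x' y' z' using that by simp
    show ?thesis
      using Qq[OF that(1)] Qq[OF that(2)] Qq[OF that(3)]
      by (elim exE, hypsubst) (simp only: qm, rule e; simp add: algebra_simps)
  qed
  have "subalgebra Q"
    unfolding subalgebra_def using cl by (auto simp: Q_def intro: span_base)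
  moreover have "\<exists>\<alpha> \<beta>. \<alpha> \<noteq> 0 \<and> \<beta> \<noteq> 0 \<and> i * i = \<alpha> *s 1 \<and> j * j = \<beta> *s 1"
    using t1 t2 ij by (intro exI[of _ "- nrm i"] exI[of _ "- nrm j"]) simp
  moreover have "\<forall>x\<in>Q. \<forall>y\<in>Q. \<forall>z\<in>Q. (x * y) * z = x * (y * z)" using as by simp
  ultimately show ?thesis
    unfolding quaternion_generators_def Q_def[symmetric]
    using o(2) orthogonal_independent[OF o(1)] t3 by simp
qed

lemma subalgebra_conj:
  assumes "subalgebra Q" "q \<in> Q"
  shows "conj q \<in> Q"
proof -
  have "subspace Q" "1 \<in> Q" using assms(1) unfolding subalgebra_def by simp_all
  from subspace_diff[OF this(1) subspace_scale[OF this] assms(2)]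
  show ?thesis by (simp only: conj_eq)
qed

text \<open>The dimension is exactly 8: the spanning vectors of the given double are orthogonal.\<close>

lemma octonion_basis_ex: "\<exists>T. finite T \<and> independent T \<and> card T = 8 \<and> span T = UNIV"
proof (rule doubling_facts)
  fix A i j l
  assume c: "conj i = - i" "conj j = - j" "conj l = - l" "l \<noteq> 0"
    and gen: "quaternion_generators A i j" and ql: "\<forall>q\<in>A. q * l = l * conj q"
    and sp: "span ({1, i, j, i * j} \<union> (\<lambda>q. q * l) ` {1, i, j, i * j}) = UNIV"
  have ind: "independent {1, i, j, i * j}" and ji: "j * i = - (i * j)"
    and sA: "span {1, i, j, i * j} = A" and sub: "subalgebra A"
    using gen unfolding quaternion_generators_def by simp_all
  have "i \<noteq> 0" "j \<noteq> 0" using ind dependent_zero[of "{1, i, j, i * j}"] by auto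
  moreover have "tr i = 0" "tr j = 0" using add_conj[of i] add_conj[of j] c by simp_all
  moreover have "bil i j = 0" using mult_conj_polar[of i j] c ji by simp
  ultimately have o: "orthogonal {1, i, j, i * j}" "card {1, i, j, i * j} = 4"
    using orthogonal_quaternion_basis by simp_all
  have perp: "bil q l = 0" if "q \<in> A" for q
    using mult_conj_polar[of q l] ql that c by simp
  have SA: "{1, i, j, i * j} \<subseteq> A" unfolding sA[symmetric] by (rule span_superset)
  have "bil (conj r * q) l = 0" if "q \<in> {1, i, j, i * j}" "r \<in> {1, i, j, i * j}" for q r
  proof (rule perp)
    have "q \<in> A" "r \<in> A" using that SA by (simp_all only: subset_iff)
    then show "conj r * q \<in> A" using sub subalgebra_conj[OF sub] unfolding subalgebra_def by simp
  qed
  note d = orthogonal_double[OF o(1) c(4) this]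
  have "finite ({1, i, j, i * j} \<union> (\<lambda>q. q * l) ` {1, i, j, i * j})" by simp
  moreover have "card ({1, i, j, i * j} \<union> (\<lambda>q. q * l) ` {1, i, j, i * j}) = 8"
    using d(2) o(2) by simp
  ultimately show ?thesis using orthogonal_independent[OF d(1)] sp by (intro exI conjI)
qed

lemma orthogonal_card_8_span:
  assumes "orthogonal S" "card S = 8"
  shows "span S = UNIV"
proof -
  obtain T where T: "finite T" "independent T" "card T = 8" "span T = UNIV"
    using octonion_basis_ex by blast
  have "x \<in> span S" for x
  proof (rule ccontr)
    assume x: "x \<notin> span S"
    have "independent (insert x S)"
      using independent_insertI[OF x orthogonal_independent[OF assms(1)]] .
    then have "card (insert x S) \<le> 8" using independent_span_bound[of T "insert x S"] T by simp
    moreover have "x \<notin> S" using x span_base by blast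
    moreover have "finite S" using assms(1) unfolding orthogonal_def by blast
    ultimately show False using assms(2) by simp
  qed
  then show ?thesis by blast
qed

text \<open>Gram--Schmidt: fewer than eight orthogonal vectors can be extended, and the new vector can be
  chosen so that a prescribed \<open>x\<close> enters the span.\<close>

lemma orthogonal_extend:
  assumes S: "orthogonal S" and card: "card S < 8"
  obtains y where "y \<noteq> 0" "\<forall>s\<in>S. bil y s = 0" "x \<in> span (insert y S)"
proof -
  obtain T where T: "finite T" "independent T" "card T = 8" "span T = UNIV"
    using octonion_basis_ex by blast
  have fin: "finite S" using S unfolding orthogonal_def by blast
  have "\<exists>z. z \<notin> span S"
  proof (rule ccontr)
    assume "\<nexists>z. z \<notin> span S"
    then have "T \<subseteq> span S" by blast
    then show False using independent_span_bound[OF fin T(2)] T(3) card by simp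
  qed
  then obtain z where z: "z \<notin> span S" "x \<in> span S \<or> z = x" by blast
  define s where "s = (\<Sum>v\<in>S. (bil z v / bil v v) *s v)"
  define y where "y = z - s"
  have sS: "s \<in> span S" unfolding s_def by (intro span_sum span_scale span_base)
  have "bil y v = 0" if v: "v \<in> S" for v
  proof -
    have "bil s v = (\<Sum>u\<in>S. (bil z u / bil u u) * bil u v)"
      by (simp add: s_def bil_sum_left bil_scale_left)
    also have "\<dots> = (\<Sum>u\<in>S. if u = v then (bil z v / bil v v) * bil v v else 0)"
      using S v by (intro sum.cong) (auto simp: orthogonal_def)
    also have "\<dots> = (bil z v / bil v v) * bil v v" using fin v by simp
    also have "\<dots> = bil z v"
      using v S by (auto simp: bil_self orthogonal_def)
    finally show ?thesis by (simp add: y_def bil_diff)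
  qed
  moreover have "y \<noteq> 0" using sS z by (auto simp: y_def)
  moreover have "x \<in> span (insert y S)"
  proof -
    have m: "span S \<subseteq> span (insert y S)" by (intro span_mono) blast
    have "y + s \<in> span (insert y S)" using sS m span_base by (intro span_add) auto
    then show ?thesis using z m by (auto simp: y_def)
  qed
  ultimately show thesis using that[of y] by simp
qed

lemma span_perp:
  assumes "\<forall>s\<in>S. bil y s = 0" "x \<in> span S"
  shows "bil y x = 0"
  using assms(2)
proof (rule span_induct)
  show "subspace {x. bil y x = 0}" by (simp add: subspace_def bil_simps)
qed (use assms(1) in blast)

text \<open>The algebra is the double of a quaternion subalgebra \<open>Q\<close> with orthogonal standard
  basis, by any nonzero vector \<open>l\<close> orthogonal to \<open>Q\<close>. The product formula comes from the linearised alternative laws, the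
  direct decomposition from the dimension.\<close>

lemma cayley_dickson_doubleI:
  assumes gen: "quaternion_generators Q i j" and S: "orthogonal {1, i, j, i * j}"
    and l: "l \<noteq> 0" and perp: "\<And>q. q \<in> Q \<Longrightarrow> bil q l = 0"
  shows "cayley_dickson_double conj Q (- nrm l) l"
proof -
  have sub: "subalgebra Q" and sp: "span {1, i, j, i * j} = Q" and card: "card {1, i, j, i * j} = 4"
    using gen unfolding quaternion_generators_def by simp_all
  have sQ: "subspace Q" and oneQ: "1 \<in> Q" and mQ: "\<And>x y. x \<in> Q \<Longrightarrow> y \<in> Q \<Longrightarrow> x * y \<in> Q"
    using sub unfolding subalgebra_def by simp_all
  have cQ: "conj q \<in> Q" if "q \<in> Q" for q using subalgebra_conj[OF sub that] .
  have cl: "conj l = - l" using perp[OF oneQ] by (simp add: conj_eq tr_def bil_commute)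
  have lq: "l * q = conj q * l" if "q \<in> Q" for q
    using conj_mult_polar[of q l] perp[OF that] by (simp add: cl)
  have 1: "q * (t * l) = (t * q) * l" if "q \<in> Q" "t \<in> Q" for q t
  proof -
    have "q * (l * conj t) + conj l * (conj q * conj t) = 0"
      using polar_left[of "conj q" l "conj t"] perp[OF cQ[OF that(1)]] by simp
    then have "q * (l * conj t) = l * conj (t * q)" by (simp add: cl conj_mult)
    then show ?thesis using that by (simp add: lq cQ mQ)
  qed
  have 2: "(r * l) * s = (r * conj s) * l" if "s \<in> Q" for r s
    using polar_right[of r l "conj s"] perp[OF cQ[OF that]] by (simp add: cl bil_commute)
  have ll: "(r * l) * l = - nrm l *s r" for r
    using arg_cong[OF mult_conj_cancel_right[of r l], of uminus] by (simp add: cl)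
  have 3: "(r * l) * (t * l) = - nrm l *s (conj t * r)" if "r \<in> Q" "t \<in> Q" for r t
  proof -
    have b: "bil q (r * l) = 0" if "q \<in> Q" for q
      using perp[OF mQ[OF cQ[OF \<open>r \<in> Q\<close>] that]] by (simp add: bil_adjoint)
    have "conj (r * l) = - (r * l)"
      using b[OF oneQ] by (simp add: conj_eq tr_def bil_commute)
    then have "(r * l) * (t * l) = conj t * ((r * l) * l)"
      using polar_left[of "- (r * l)" t l] b[OF that(2)]
      by (simp add: conj_minus bil_minus bil_commute)
    then show ?thesis by (simp add: ll mult_scale_right)
  qed
  have "direct_double Q l"
    unfolding direct_double_def
  proof
    fix x
    have SQ: "{1, i, j, i * j} \<subseteq> Q" unfolding sp[symmetric] by (rule span_superset)
    have "bil (conj r * q) l = 0" if "q \<in> {1, i, j, i * j}" "r \<in> {1, i, j, i * j}" for q r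
    proof (rule perp)
      have "q \<in> Q" "r \<in> Q" using that SQ by (simp_all only: subset_iff)
      then show "conj r * q \<in> Q" using mQ cQ by simp
    qed
    note d = orthogonal_double[OF S l this]
    have all: "span ({1, i, j, i * j} \<union> (\<lambda>q. q * l) ` {1, i, j, i * j}) = UNIV"
      using orthogonal_card_8_span[OF d(1)] d(2) card by simp
    define D where "D = {q + r * l | q r. q \<in> Q \<and> r \<in> Q}"
    have DI: "q + r * l \<in> D" if "q \<in> Q" "r \<in> Q" for q r
      unfolding D_def using that by auto
    have DE: "\<exists>q r. q \<in> Q \<and> r \<in> Q \<and> y = q + r * l" if "y \<in> D" for y
      using that unfolding D_def by auto
    have "subspace D"
    proof (rule subspaceI)
      show "0 \<in> D" using DI[OF subspace_0[OF sQ] subspace_0[OF sQ]] by simp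
    next
      fix x y assume "x \<in> D" "y \<in> D"
      with DE obtain q r s t where "q \<in> Q" "r \<in> Q" "s \<in> Q" "t \<in> Q" "x = q + r * l" "y = s + t * l"
        by meson
      moreover from this have "(q + s) + (r + t) * l \<in> D" by (intro DI subspace_add[OF sQ])
      ultimately show "x + y \<in> D" by (simp add: mult_add_left algebra_simps)
    next
      fix c x assume "x \<in> D"
      with DE obtain q r where "q \<in> Q" "r \<in> Q" "x = q + r * l" by meson
      moreover from this have "c *s q + (c *s r) * l \<in> D" by (intro DI subspace_scale[OF sQ])
      ultimately show "c *s x \<in> D" by (simp add: mult_scale_left scale_right_distrib)
    qed
    moreover have "{1, i, j, i * j} \<union> (\<lambda>q. q * l) ` {1, i, j, i * j} \<subseteq> D"
    proof -
      have "q \<in> D" if "q \<in> Q" for q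
        using DI[OF that subspace_0[OF sQ]] by simp
      moreover have "r * l \<in> D" if "r \<in> Q" for r
        using DI[OF subspace_0[OF sQ] that] by simp
      ultimately show ?thesis using SQ by (intro Un_least subsetI) (auto simp only: subset_iff)
    qed
    ultimately have "UNIV \<subseteq> D"
      unfolding all[symmetric] by (rule span_minimal[rotated])
    then have "x \<in> D" by (rule subsetD) simp
    with DE obtain q r where x: "q \<in> Q" "r \<in> Q" "x = q + r * l" by meson
    have uniq: "q' = q \<and> r' = r" if that: "q' \<in> Q \<and> r' \<in> Q \<and> x = q' + r' * l" for q' r'
    proof -
      have e: "q' - q = (r - r') * l" using that x(3) by (simp add: mult_diff_left algebra_simps)
      have "bil (q' - q) ((r - r') * l) = 0"
        unfolding bil_adjoint using that x by (intro perp mQ cQ subspace_diff[OF sQ]) simp_all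
      then have "q' - q = 0" unfolding e[symmetric] by (simp add: bil_self)
      then show ?thesis using e l by simp
    qed
    show "\<exists>!(q, r). q \<in> Q \<and> r \<in> Q \<and> x = q + r * l"
    proof (rule ex1I[of _ "(q, r)"])
      show "case (q, r) of (q, r) \<Rightarrow> q \<in> Q \<and> r \<in> Q \<and> x = q + r * l" using x by simp
      fix p assume "case p of (q, r) \<Rightarrow> q \<in> Q \<and> r \<in> Q \<and> x = q + r * l"
      then show "p = (q, r)" using uniq[of "fst p" "snd p"] by (cases p) simp
    qed
  qed
  moreover have "(q + r * l) * (s + t * l) = (q * s + - nrm l *s (conj t * r)) + (t * q + r * conj s) * l"
    if "q \<in> Q" "r \<in> Q" "s \<in> Q" "t \<in> Q" for q r s t
  proof -
    have "(q + r * l) * (s + t * l) = (q * s + (r * l) * s) + (q * (t * l) + (r * l) * (t * l))"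
      by (simp only: mult_add_left mult_add_right)
    also have "\<dots> = (q * s + (r * conj s) * l) + ((t * q) * l + - nrm l *s (conj t * r))"
      using that by (simp only: 1 2 3)
    finally show ?thesis by (simp add: mult_add_left add_ac)
  qed
  ultimately show ?thesis
    unfolding cayley_dickson_double_def using l by simp
qed

text \<open>Any two elements \<open>u\<close>, \<open>v\<close> lie in a quaternion subalgebra, and the algebra is
  the double of it. The generator \<open>j\<close>, orthogonal to both 1 and \<open>u\<close>, serves later
  to conjugate \<open>u\<close> to \<open>conj u\<close>.\<close>

lemma two_elements_quaternion:
  obtains Q l j where "quaternion_subalgebra Q" "subalgebra Q"
    "\<forall>x\<in>Q. \<forall>y\<in>Q. \<forall>z\<in>Q. (x * y) * z = x * (y * z)"
    "u \<in> Q" "v \<in> Q" "l + conj l = 0" "cayley_dickson_double conj Q (- nrm l) l"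
    "j \<noteq> 0" "tr j = 0" "bil j u = 0"
proof -
  have "orthogonal {1}" unfolding orthogonal_def by simp
  then obtain i where i: "i \<noteq> 0" "tr i = 0" "u \<in> span {i, 1}"
    using orthogonal_extend[of "{1}" u] unfolding tr_def by auto
  have i1: "i \<noteq> 1" using i(2) by (auto simp: tr_one)
  have "orthogonal {i, 1}" using i
    unfolding orthogonal_def by (auto simp: tr_def bil_commute)
  moreover have "card {i, 1} < 8" using i1 by simp
  ultimately obtain j where j': "j \<noteq> 0" "\<forall>s\<in>{i, 1}. bil j s = 0" "v \<in> span {j, i, 1}"
    by (rule orthogonal_extend[where x = v])
  have j: "j \<noteq> 0" "tr j = 0" "bil j i = 0" "v \<in> span {j, i, 1}"
    using j' by (simp_all add: tr_def)
  have ij: "i \<noteq> 0" "j \<noteq> 0" "tr i = 0" "tr j = 0" "bil i j = 0"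
    using i j by (simp_all add: bil_commute)
  note o = orthogonal_quaternion_basis[OF ij]
  define Q where "Q = span {1, i, j, i * j}"
  have gen: "quaternion_generators Q i j" unfolding Q_def by (rule quaternion_generatorsI[OF ij])
  have "card {1, i, j, i * j} < 8" using o(2) by simp
  with o(1) obtain l where l: "l \<noteq> 0" "\<forall>s\<in>{1, i, j, i * j}. bil l s = 0"
    by (rule orthogonal_extend)
  have lQ: "bil q l = 0" if "q \<in> Q" for q
    using span_perp[OF l(2)] that unfolding Q_def bil_commute[of q] by simp
  have "{i, 1} \<subseteq> {1, i, j, i * j}" "{j, i, 1} \<subseteq> {1, i, j, i * j}" by auto
  then have uv: "u \<in> Q" "v \<in> Q"
    unfolding Q_def using i(3) j(4) span_mono by (meson subsetD)+
  have ju: "bil j u = 0"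
    using span_perp[OF j'(2) i(3)] .
  have "tr l = 0" using l(2) by (simp add: tr_def)
  then have ll: "l + conj l = 0" by (simp add: add_conj)
  show thesis
  proof (rule that)
    show "quaternion_subalgebra Q" unfolding quaternion_subalgebra_def using gen by blast
    show "cayley_dickson_double conj Q (- nrm l) l" by (rule cayley_dickson_doubleI[OF gen o(1) l(1) lQ])
  qed (use gen uv ll j ju in \<open>simp_all add: quaternion_generators_def\<close>)
qed

end

section \<open>Polynomials with a single root\<close>

text \<open>An associative subalgebra of the octonions. Computations with several elements take place
  here; the quaternion subalgebra through \<open>lam\<close> and \<open>nu\<close> is the intended instance.\<close>

locale octonion_associative_subalgebra = octonion_division_algebra_char_0 scale conj
  for scale :: "'f::field_char_0 \<Rightarrow> 'o::{ab_group_add, power} \<Rightarrow> 'o" (infixr "*s" 75)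
    and conj :: "'o \<Rightarrow> 'o" +
  fixes Q :: "'o set"
  assumes sub: "subalgebra Q"
    and assoc: "x \<in> Q \<Longrightarrow> y \<in> Q \<Longrightarrow> z \<in> Q \<Longrightarrow> (x * y) * z = x * (y * z)"
begin

lemma subspace_Q: "subspace Q" and Q_one [simp]: "1 \<in> Q"
  and Q_mult [simp]: "x \<in> Q \<Longrightarrow> y \<in> Q \<Longrightarrow> x * y \<in> Q"
  using sub unfolding subalgebra_def by simp_all

lemmas Q_zero [simp] = subspace_0[OF subspace_Q]
lemmas Q_add [simp] = subspace_add[OF subspace_Q]
lemmas Q_diff [simp] = subspace_diff[OF subspace_Q]
lemmas Q_minus [simp] = subspace_neg[OF subspace_Q]
lemmas Q_scale [simp] = subspace_scale[OF subspace_Q]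
lemmas Q_conj [simp] = subalgebra_conj[OF sub]

lemma Q_power [simp]: "x \<in> Q \<Longrightarrow> x ^ n \<in> Q"
  by (induction n) simp_all

lemma power_commutes_Q: "x \<in> Q \<Longrightarrow> x ^ n * x = x * x ^ n"
  by (induction n) (simp_all add: assoc mult_one_left mult_one_right)

lemma conj_power: "x \<in> Q \<Longrightarrow> conj (x ^ n) = conj x ^ n"
  by (induction n) (simp_all add: conj_mult power_commutes_Q)

text \<open>The two lemmas below characterise when \<open>lam\<close> is the only root of
  \<open>(x - nu) * (x - lam)\<close>: when \<open>nu\<close> and \<open>lam\<close> have the same trace and
  norm, and the polynomial is not the minimal polynomial of a nonscalar element.

  A further root \<open>lam + u\<close> amounts to \<open>u * (lam + u) = nu * u\<close>, that is, to the Sylvester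
  equation \<open>y * nu - lam * y = 1\<close> for the inverse \<open>y\<close> of \<open>u\<close>. If the value \<open>d\<close> at
  \<open>nu\<close> of the minimal polynomial of \<open>lam\<close> is nonzero, then
  \<open>y = (nu - conj lam) / d\<close> solves it.\<close>

lemma sole_root_necessary:
  assumes Q: "lam \<in> Q" "nu \<in> Q"
    and uniq: "\<And>w. w * w - (nu + lam) * w + nu * lam = 0 \<Longrightarrow> w = lam"
  shows "tr nu = tr lam" "nrm nu = nrm lam" "nu = conj lam \<Longrightarrow> lam = conj lam"
proof -
  define d where "d = nu * nu - tr lam *s nu + nrm lam *s 1"
  have d': "d = (tr nu - tr lam) *s nu + (nrm lam - nrm nu) *s 1"
    by (simp add: d_def square_eq scale_left_diff_distrib)
  have dQ: "d \<in> Q" using Q by (simp add: d_def)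
  have d0: "d = 0"
  proof (rule ccontr)
    assume dn: "d \<noteq> 0"
    define e where "e = nu - conj lam"
    have eQ: "e \<in> Q" using Q by (simp add: e_def)
    have en: "e \<noteq> 0"
    proof
      assume "e = 0"
      then have "nu = conj lam" by (simp add: e_def)
      then show False using dn by (simp add: d')
    qed
    define u where "u = (1 / nrm e) *s (d * conj e)"
    have uQ: "u \<in> Q" using dQ eQ by (simp add: u_def)
    have ue: "u * e = d"
      using en by (simp add: u_def mult_scale_left conj_mult_cancel_right)
    have le: "(lam + u) * e = e * nu"
      by (simp add: mult_add_left ue)
        (simp add: e_def d_def alg_simps conj_eq[of lam] square_eq[of lam] algebra_simps)
    have dnu: "d * nu = nu * d"
      by (simp add: d' alg_simps)
    have "(u * (lam + u)) * e = u * ((lam + u) * e)" using Q uQ eQ by (simp add: assoc)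
    also have "\<dots> = (u * e) * nu" using Q uQ eQ by (simp add: le assoc)
    also have "\<dots> = nu * (u * e)" by (simp add: ue dnu)
    also have "\<dots> = (nu * u) * e" using Q uQ eQ by (simp add: assoc)
    finally have "(u * (lam + u) - nu * u) * e = 0" by (simp add: mult_diff_left)
    then have "u * (lam + u) = nu * u" using en by simp
    then have "(lam + u) * (lam + u) - (nu + lam) * (lam + u) + nu * lam = 0"
      by (simp add: alg_simps algebra_simps)
    then have "lam + u = lam" by (rule uniq)
    then show False using ue dn by simp
  qed
  have "tr nu = tr lam \<and> nrm nu = nrm lam"
  proof (cases "tr nu = tr lam")
    case True
    then show ?thesis using d0 d' by simp
  next
    case False
    define r where "r = (nrm nu - nrm lam) / (tr nu - tr lam)"
    have "(tr nu - tr lam) *s nu - (nrm nu - nrm lam) *s 1 = d"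
      by (simp add: d' scale_left_diff_distrib)
    moreover have "(tr nu - tr lam) * r = nrm nu - nrm lam" using False by (simp add: r_def)
    ultimately have "(tr nu - tr lam) *s nu = (tr nu - tr lam) *s (r *s 1)"
      using d0 by simp
    then have nu: "nu = r *s 1" using False by (simp only: scale_cancel_left) simp
    have "(r * r - tr lam * r + nrm lam) *s (1::'o) = 0"
      using d0 unfolding d_def nu by (simp add: alg_simps scale_left_distrib scale_left_diff_distrib)
    then have "r * r - tr lam * r + nrm lam = 0" by (simp only: scale_one_eq_0_iff)
    then have "nrm (lam + (- r) *s 1) = 0"
      by (simp only: nrm_add nrm_scale nrm_one bil_scale_right tr_def[symmetric]) (simp add: algebra_simps)
    then have "lam = nu" by (simp add: nu)
    then show ?thesis by simp
  qed
  then show "tr nu = tr lam" "nrm nu = nrm lam" by simp_all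
  assume nu: "nu = conj lam"
  have "conj lam * conj lam - (nu + lam) * conj lam + nu * lam = 0"
    by (simp add: nu mult_add_left mult_conj conj_mult_self)
  then have "conj lam = lam" by (rule uniq)
  then show "lam = conj lam" by simp
qed

text \<open>The candidate \<open>w\<close> is an arbitrary octonion. If \<open>nu = conj lam\<close>, the polynomial is
  the square of \<open>x - lam\<close> with \<open>lam\<close> scalar. Otherwise, replacing \<open>w * w\<close> by
  \<open>tr w *s w - nrm w *s 1\<close> turns the equation into a linear one, which forces \<open>w\<close> into
  \<open>Q\<close>. There the Sylvester equation has no solution: every value
  \<open>z = y * nu - lam * y\<close> satisfies \<open>z * nu = conj lam * z\<close>, which fails for
  \<open>z = 1\<close>.\<close>

lemma sole_root_sufficient:
  assumes Q: "lam \<in> Q" "nu \<in> Q"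
    and tr: "tr nu = tr lam" and nrm: "nrm nu = nrm lam" and sc: "nu = conj lam \<Longrightarrow> lam = conj lam"
    and w: "w * w - (nu + lam) * w + nu * lam = 0"
  shows "w = lam"
proof (cases "nu = conj lam")
  case True
  then have nu: "nu = lam" using sc by simp
  have "lam + lam = tr lam *s 1" using add_conj[of lam] sc[OF True] by simp
  then have "2 *s lam = 2 *s ((tr lam / 2) *s 1)"
    by (simp add: scale_left_distrib[of 1 1, simplified])
  then have lam: "lam = (tr lam / 2) *s 1" by (simp only: scale_cancel_left) simp
  have c: "lam * x = x * lam" for x by (subst (1 2) lam) (simp add: alg_simps)
  have "(w - lam) * (w - lam) = 0"
    using w c[of w] by (simp add: nu alg_simps algebra_simps)
  then show ?thesis by simp
next
  case False
  \<comment> \<open>the linear coefficient after \<open>w * w\<close> has been reduced\<close>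
  define h where "h = tr w *s 1 - (nu + lam)"
  have hQ: "h \<in> Q" using Q by (simp add: h_def)
  have hw: "h * w = nrm w *s 1 - nu * lam"
    using w by (simp add: h_def mult_diff_left mult_scale_left mult_one_left square_eq algebra_simps)
  have "h \<noteq> 0"
  proof
    assume "h = 0"
    then have e: "nu + lam = tr w *s 1" by (simp add: h_def)
    then have "tr (nu + lam) = tr (tr w *s 1)" by simp
    then have "2 * tr lam = 2 * tr w" by (simp add: tr_simps tr)
    then have "tr w = tr lam" by simp
    then have "nu = conj lam" using e by (simp add: conj_eq algebra_simps)
    then show False using False by simp
  qed
  have "(1 / nrm h) *s (conj h * (nrm w *s 1 - nu * lam)) \<in> Q" using Q hQ by simp
  then have wQ: "w \<in> Q" unfolding hw[symmetric] using \<open>h \<noteq> 0\<close> by (simp add: conj_mult_cancel_left)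
  define u where "u = w - lam"
  have uQ: "u \<in> Q" using wQ Q by (simp add: u_def)
  have uw: "u * w = nu * u" using w by (simp add: u_def alg_simps algebra_simps)
  show ?thesis
  proof (rule ccontr)
    assume "w \<noteq> lam"
    then have un: "u \<noteq> 0" by (simp add: u_def)
    define y where "y = conj u"
    have yQ: "y \<in> Q" using uQ by (simp add: y_def)
    have "nrm u *s (w * y) = (y * (u * w)) * y"
      by (simp add: y_def conj_mult_cancel_left mult_scale_left)
    also have "\<dots> = (y * nu) * (u * y)" using yQ uQ Q by (simp add: uw assoc)
    also have "\<dots> = nrm u *s (y * nu)" by (simp add: y_def mult_conj)
    finally have wy: "w * y = y * nu" using un by simp
    have "w * y = nrm u *s 1 + lam * y"
      using mult_conj[of u] by (simp add: u_def y_def mult_diff_left algebra_simps)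
    from trans[OF this[symmetric] wy] have k: "nrm u *s 1 = y * nu - lam * y"
      by (simp only: eq_diff_eq)
    have "nrm u *s (nu - conj lam) = (nrm u *s 1) * nu - conj lam * (nrm u *s 1)"
      by (simp add: scale_right_diff_distrib)
    also have "\<dots> = y * (nu * nu) - tr lam *s (y * nu) + nrm lam *s y"
      unfolding k using yQ Q
      by (simp add: mult_diff_left mult_diff_right assoc conj_mult_cancel_left)
        (simp add: conj_eq mult_diff_left mult_one_left algebra_simps)
    also have "\<dots> = 0"
      by (simp add: square_eq tr nrm mult_diff_right mult_scale_right mult_one_right)
    finally show False using un False by simp
  qed
qed

end

section \<open>Recurrences over a quaternion subalgebra\<close>

context octonion_associative_subalgebra
begin

text \<open>The data of a second solution \<open>(s + k t) * lam ^ k\<close> of the recurrence.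

  In the scalar case \<open>nu = lam\<close>, and \<open>s = 0\<close>, \<open>t = 1 / lam\<close> work. Otherwise let
  \<open>D = lam - conj lam\<close> and \<open>d = nu - conj lam\<close>. Every multiple \<open>e\<close> of \<open>d\<close>
  satisfies \<open>e * lam = nu * e\<close>. Commutators with \<open>lam\<close> only produce elements
  anticommuting with \<open>D\<close>; the remaining component of \<open>d\<close> is a multiple of \<open>D\<close>,
  because \<open>d * D + D * d\<close> is a scalar, and it is absorbed by \<open>t * lam\<close>. The witnesses are
  multiplied by common denominators.\<close>

lemma jordan_data:
  assumes Q: "lam \<in> Q" "nu \<in> Q" and lam0: "lam \<noteq> 0"
    and tr: "tr nu = tr lam" and nrm: "nrm nu = nrm lam" and sc: "nu = conj lam \<Longrightarrow> lam = conj lam"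
  obtains s t e where "s \<in> Q" "t \<in> Q" "e \<in> Q" "e \<noteq> 0" "t * lam = lam * t"
    "s * lam - lam * s + t * lam = e" "e * lam = nu * e"
proof (cases "nu = conj lam")
  case True
  then have "nu = lam" using sc by simp
  then show thesis
    using that[of 0 "(1 / nrm lam) *s conj lam" 1] Q lam0
    by (simp add: mult_scale_left mult_scale_right mult_conj conj_mult_self mult_one_left mult_one_right)
next
  case False
  define D where "D = lam - conj lam"
  define d where "d = nu - conj lam"
  have DQ: "D \<in> Q" and dQ: "d \<in> Q" using Q by (simp_all add: D_def d_def)
  have lamD: "2 *s lam = tr lam *s 1 + D"
    by (simp add: D_def conj_eq scale_left_distrib[of 1 1, simplified])
  have trD: "tr D = 0" and trd: "tr d = 0" by (simp_all add: D_def d_def tr_simps tr)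
  have DD: "D * D = - nrm D *s 1" using square_eq[of D] trD by simp
  have sc: "d * D + D * d = - bil d D *s 1"
  proof -
    have "- (d * D + D * d) = bil d D *s 1"
      using mult_conj_polar[of d D] trD trd by (simp add: conj_eq)
    then have "- (- (d * D + D * d)) = - (bil d D *s 1)" by (simp only:)
    then show ?thesis by (simp only: minus_minus scale_minus_left)
  qed
  have Dlam: "D * lam = lam * D"
    by (simp add: D_def mult_diff_left mult_diff_right mult_conj conj_mult_self)
  have lc: "lam * conj lam = nrm lam *s 1" "conj lam * lam = nrm lam *s 1"
    by (simp_all add: mult_conj conj_mult_self)
  have dl: "d * lam = nu * d"
    by (simp add: d_def mult_diff_left mult_diff_right conj_mult_self)
      (simp add: conj_eq[of lam] mult_diff_right mult_scale_right mult_one_right square_eq[of nu] tr nrm)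
  have D0: "D \<noteq> 0"
  proof
    assume "D = 0"
    then have "lam = conj lam" by (simp add: D_def)
    then have "2 *s lam = tr lam *s 1" using lamD \<open>D = 0\<close> by simp
    then have "lam = (tr lam / 2) *s 1"
      by (metis (no_types) scale_scale scale_cancel_left zero_neq_numeral nonzero_mult_div_cancel_left times_divide_eq_right)
    then obtain r where r: "lam = r *s 1" by blast
    have "tr nu = 2 * r" "nrm nu = r * r" by (simp_all add: tr nrm r tr_simps nrm_scale)
    then have "nrm (nu + (- r) *s 1) = 0"
      by (simp only: nrm_add nrm_scale nrm_one bil_scale_right tr_def[symmetric]) (simp add: algebra_simps)
    then have "nu = lam" by (simp add: r)
    then show False using False \<open>lam = conj lam\<close> by simp
  qed
  define s where "s = nrm lam *s (d * D - D * d)"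
  define t where "t = (- bil d D) *s (D * conj lam)"
  define e where "e = (- 2 * nrm D * nrm lam) *s d"
  show thesis
  proof (rule that)
    show "s \<in> Q" "t \<in> Q" "e \<in> Q" using DQ dQ Q by (simp_all add: s_def t_def e_def)
    show "e \<noteq> 0" using D0 lam0 False by (simp add: e_def d_def)
    show "e * lam = nu * e" by (simp add: e_def mult_scale_left mult_scale_right dl)
    have tl: "t * lam = (- bil d D * nrm lam) *s D"
      by (simp add: t_def mult_scale_left conj_mult_cancel_right)
    have "lam * (D * conj lam) = D * (lam * conj lam)"
      using Q DQ by (simp add: assoc[symmetric] Dlam)
    then show "t * lam = lam * t"
      unfolding tl by (simp add: t_def mult_scale_right mult_conj mult_one_right)
    have two: "(2 * c) *s x = c *s x + c *s x" for c x
      unfolding mult_2 by (rule scale_left_distrib)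
    have four: "(4 * c) *s x = c *s x + c *s x + c *s x + c *s x" for c x
    proof -
      have "(4 * c) *s x = (2 * (2 * c)) *s x" by simp
      then show ?thesis by (simp only: two add.assoc)
    qed
    have "2 *s (s * lam - lam * s) = s * (2 *s lam) - (2 *s lam) * s"
      by (simp add: mult_scale_left mult_scale_right scale_right_diff_distrib)
    also have "\<dots> = s * D - D * s"
      unfolding lamD by (simp add: mult_add_left mult_add_right)
    also have "\<dots> = nrm lam *s (d * (D * D) - 2 *s (D * (d * D)) + (D * D) * d)"
      using DQ dQ by (simp add: s_def mult_scale_left mult_scale_right mult_diff_left mult_diff_right assoc
          scale_left_distrib[of 1 1, simplified] scale_right_distrib scale_right_diff_distrib algebra_simps)
    also have "D * (d * D) = - bil d D *s D + nrm D *s d"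
    proof -
      have "D * (d * D) = D * (- bil d D *s 1 - D * d)" unfolding sc[symmetric] by simp
      also have "\<dots> = - bil d D *s D - (D * D) * d"
        using DQ dQ by (simp add: mult_diff_right mult_scale_right mult_one_right assoc)
      finally show ?thesis by (simp add: DD mult_scale_left mult_one_left)
    qed
    finally have "2 *s (s * lam - lam * s) = 2 *s (nrm lam *s (bil d D *s D - 2 *s nrm D *s d))"
      by (simp add: DD scale_simps scale_left_distrib[of 1 1, simplified] two four algebra_simps)
    then have "s * lam - lam * s = nrm lam *s (bil d D *s D - 2 *s nrm D *s d)"
      by (simp only: scale_cancel_left) simp
    then show "s * lam - lam * s + t * lam = e"
      by (simp add: tl e_def scale_simps algebra_simps)
  qed
qed

lemma two_step_eqI:
  fixes u v :: "nat \<Rightarrow> 'o"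
  assumes "\<And>k. u (k + 2) = p * u (k + 1) - q * u k" "\<And>k. v (k + 2) = p * v (k + 1) - q * v k"
    and "u 0 = v 0" "u 1 = v 1"
  shows "u k = v k"
proof -
  have "u k = v k \<and> u (k + 1) = v (k + 1)"
  proof (induction k)
    case 0
    then show ?case using assms by simp
  next
    case (Suc k)
    then show ?case using assms(1,2)[of k] by simp
  qed
  then show ?thesis by simp
qed

text \<open>Both \<open>lam ^ k\<close> and \<open>(s + k t) * lam ^ k\<close> solve the recurrence. The initial values
  lead to \<open>e * b' = u 1 - lam * u 0\<close>, which can be solved for \<open>b'\<close> because \<open>e\<close> is
  nonzero.\<close>

lemma left_recurrence_solution:
  assumes Q: "lam \<in> Q" "nu \<in> Q" and lam0: "lam \<noteq> 0"
    and tr: "tr nu = tr lam" and nrm: "nrm nu = nrm lam" and sc: "nu = conj lam \<Longrightarrow> lam = conj lam"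
    and uQ: "\<And>k. u k \<in> Q" and rec: "\<And>k. u (k + 2) = (nu + lam) * u (k + 1) - (nu * lam) * u k"
  shows "\<exists>s\<in>Q. \<exists>t\<in>Q. \<exists>b\<in>Q. \<exists>b'\<in>Q.
    \<forall>k. u k = lam ^ k * b + ((s + of_nat k *s t) * lam ^ k) * b'"
proof -
  obtain s t e where S: "s \<in> Q" "t \<in> Q" "e \<in> Q" "e \<noteq> 0" and tl: "t * lam = lam * t"
    and ste: "s * lam - lam * s + t * lam = e" and el: "e * lam = nu * e"
    using jordan_data[OF Q lam0 tr nrm sc] by blast
  define b' where "b' = (1 / nrm e) *s (conj e * (u 1 - lam * u 0))"
  define b where "b = u 0 - s * b'"
  have bQ: "b' \<in> Q" "b \<in> Q" using S uQ Q by (simp_all add: b'_def b_def)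
  have eb: "e * b' = u 1 - lam * u 0"
    using S by (simp add: b'_def mult_scale_right mult_conj_cancel_left)
  define f where "f k = (s + of_nat k *s t) * lam ^ k" for k
  have fQ: "f k \<in> Q" for k using S Q by (simp add: f_def)
  have frec: "f (k + 2) = (nu + lam) * f (k + 1) - (nu * lam) * f k" for k
  proof -
    define g where "g = s + of_nat k *s t"
    have gQ: "g \<in> Q" using S by (simp add: g_def)
    have "g * lam - lam * g + t * lam = e"
      unfolding g_def ste[symmetric] by (simp add: mult_add_left mult_add_right mult_scale_left mult_scale_right tl)
    then have gl: "g * lam = lam * g - t * lam + e" by (simp add: algebra_simps)
    have "t * (lam * lam) = (t * lam) * lam" using S Q by (simp add: assoc)
    also have "\<dots> = (lam * t) * lam" by (simp only: tl)
    also have "\<dots> = lam * (t * lam)" using S Q by (simp add: assoc)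
    finally have tll: "t * (lam * lam) = lam * (t * lam)" .
    have g1: "s + of_nat (k + 1) *s t = g + t" "s + of_nat (k + 2) *s t = g + t + t"
      by (simp_all add: g_def scale_left_distrib scale_left_distrib[of 1 1, simplified] algebra_simps)
    have "((g + t + t) * lam) * lam = (nu + lam) * ((g + t) * lam) - (nu * lam) * g"
    proof -
      have "((g + t + t) * lam) * lam = (lam * g + t * lam + e) * lam"
        by (simp add: mult_add_left gl)
      also have "\<dots> = lam * (g * lam) + lam * (t * lam) + nu * e"
        using gQ S Q by (simp add: mult_add_left assoc el tll)
      also have "nu * e = nu * (g * lam) - nu * (lam * g) + nu * (t * lam)"
        by (simp add: gl mult_diff_right mult_add_right)
      finally show ?thesis
        using gQ S Q by (simp add: mult_add_left mult_add_right assoc algebra_simps)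
    qed
    then have "(((g + t + t) * lam) * lam) * lam ^ k = ((nu + lam) * ((g + t) * lam) - (nu * lam) * g) * lam ^ k"
      by simp
    then show ?thesis
      unfolding f_def g1 g_def[symmetric] using gQ S Q by (simp add: mult_diff_left assoc)
  qed
  have "u k = lam ^ k * b + f k * b'" for k
  proof (rule two_step_eqI[where u = u and v = "\<lambda>k. lam ^ k * b + f k * b'"])
    show "u (k + 2) = (nu + lam) * u (k + 1) - (nu * lam) * u k" for k by (rule rec)
    show "lam ^ (k + 2) * b + f (k + 2) * b' =
      (nu + lam) * (lam ^ (k + 1) * b + f (k + 1) * b') - (nu * lam) * (lam ^ k * b + f k * b')" for k
      unfolding frec using fQ bQ Q
      by (simp add: mult_diff_left mult_diff_right mult_add_left mult_add_right assoc algebra_simps)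
    show "u 0 = lam ^ 0 * b + f 0 * b'" by (simp add: b_def f_def mult_one_left mult_one_right)
    have "f 1 = (s * lam + t * lam)" by (simp add: f_def mult_add_left mult_one_right)
    also have "\<dots> = lam * s + e" using ste by (simp add: algebra_simps)
    finally have "f 1 * b' = lam * (s * b') + (u 1 - lam * u 0)"
      using S Q bQ by (simp add: mult_add_left assoc eb)
    then show "u 1 = lam ^ 1 * b + f 1 * b'"
      by (simp add: b_def mult_one_right mult_diff_right)
  qed
  then show ?thesis unfolding f_def using S bQ by blast
qed

text \<open>The mirror image, obtained by conjugation: \<open>conj nu\<close> and \<open>conj lam\<close> take the
  places of \<open>lam\<close> and \<open>nu\<close>.\<close>

lemma right_recurrence_solution:
  assumes Q: "lam \<in> Q" "nu \<in> Q" and nu0: "nu \<noteq> 0"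
    and tr: "tr nu = tr lam" and nrm: "nrm nu = nrm lam" and sc: "nu = conj lam \<Longrightarrow> lam = conj lam"
    and vQ: "\<And>k. v k \<in> Q" and rec: "\<And>k. v (k + 2) = v (k + 1) * (nu + lam) - v k * (nu * lam)"
  shows "\<exists>s\<in>Q. \<exists>t\<in>Q. \<exists>b\<in>Q. \<exists>b'\<in>Q.
    \<forall>k. v k = b * nu ^ k + (b' * nu ^ k) * (s + of_nat k *s t)"
proof -
  have c0: "conj nu \<noteq> 0" using nu0 by (metis conj_conj conj_zero)
  have sc': "conj lam = conj (conj nu) \<Longrightarrow> conj nu = conj (conj nu)"
    using sc by (metis conj_conj)
  have t: "tr (conj lam) = tr (conj nu)" and n: "nrm (conj lam) = nrm (conj nu)"
    using tr nrm by simp_all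
  have rec': "conj (v (k + 2)) = (conj lam + conj nu) * conj (v (k + 1)) - (conj lam * conj nu) * conj (v k)" for k
    unfolding rec by (simp add: conj_simps add.commute)
  obtain s t b b' where S: "s \<in> Q" "t \<in> Q" "b \<in> Q" "b' \<in> Q"
    and eq: "\<And>k. conj (v k) = conj nu ^ k * b + ((s + of_nat k *s t) * conj nu ^ k) * b'"
    using left_recurrence_solution[OF Q_conj[OF Q(2)] Q_conj[OF Q(1)] c0 t n sc' Q_conj[OF vQ] rec']
    by blast
  have "v k = conj b * nu ^ k + (conj b' * nu ^ k) * (conj s + of_nat k *s conj t)" for k
  proof -
    have "v k = conj (conj nu ^ k * b + ((s + of_nat k *s t) * conj nu ^ k) * b')"
      unfolding eq[symmetric] by simp
    then show ?thesis using Q S by (simp add: conj_simps conj_power assoc)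
  qed
  moreover have "conj s \<in> Q" "conj t \<in> Q" "conj b \<in> Q" "conj b' \<in> Q" using S by simp_all
  ultimately show ?thesis by blast
qed

end

section \<open>Recurrences over the octonions\<close>

context octonion_division_algebra_char_0
begin

lemma left_eval_linear: "left_eval [:s, t:] z = s + t * (z :: 'o)"
  by (simp add: left_eval_def mult_one_right)

lemma eval_nat_linear: "eval_nat scale [:s, t:] k = s + of_nat k *s t"
  by (simp add: eval_nat_def left_eval_linear)

lemma eval_nat_one: "eval_nat scale [:1:] k = 1"
  by (simp add: eval_nat_def left_eval_def mult_one_right)

lemma left_eval_quadratic: "left_eval [:c0, c1, 1:] z = c0 + c1 * z + z * (z :: 'o)"
  by (simp add: left_eval_def mult_one_right mult_one_left numeral_2_eq_2)

lemma unique_root_recurrence_poly: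
  "unique_root (recurrence_poly c0 c1) (z :: 'o) \<longleftrightarrow>
    c0 + c1 * z + z * z = 0 \<and> (\<forall>w. c0 + c1 * w + w * w = 0 \<longrightarrow> w = z)"
  by (simp add: unique_root_def recurrence_poly_def left_eval_quadratic)

lemma map_poly_conj_recurrence_poly:
  "map_poly conj (recurrence_poly c0 c1) = recurrence_poly (conj c0) (conj c1)"
  by (simp add: recurrence_poly_def map_poly_pCons)

lemma conjugate_in_class:
  assumes q: "q \<noteq> 0" and c: "mu * q = q * (lam :: 'o)"
  shows "mu \<in> conjugacy_class lam"
proof -
  define q' where "q' = (1 / nrm q) *s conj q"
  have "q * q' = 1" "q' * q = 1" "(q * lam) * q' = mu"
    using q by (simp_all add: q'_def alg_simps mult_conj conj_mult_self c[symmetric] mult_conj_cancel_right)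
  then show ?thesis using q unfolding conjugacy_class_def by blast
qed

end

context octonion_associative_subalgebra
begin

text \<open>In the double \<open>Q + Q * l\<close> one has \<open>q * (r * l) = (r * q) * l\<close>. Hence a left
  recurrence with coefficients in \<open>Q\<close> splits into a left recurrence for the first component and
  a right recurrence for the second.\<close>

lemma double_recurrence_solution:
  assumes Q: "lam \<in> Q" "nu \<in> Q" and lam0: "lam \<noteq> 0" and nu0: "nu \<noteq> 0"
    and tr: "tr nu = tr lam" and nrm: "nrm nu = nrm lam" and sc: "nu = conj lam \<Longrightarrow> lam = conj lam"
    and cd: "cayley_dickson_double conj Q \<gamma> l"
    and ar: "\<And>k. a (k + 2) = (nu + lam) * a (k + 1) - (nu * lam) * a k"
  shows "\<exists>b1 b2 b3 b4 p1 p2 p3 p4.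
    b1 \<in> Q \<and> b2 \<in> Q \<and> b3 \<in> Q \<and> b4 \<in> Q \<and>
    linear_poly_over Q p1 \<and> linear_poly_over Q p2 \<and>
    linear_poly_over Q p3 \<and> linear_poly_over Q p4 \<and>
    (\<forall>k. a k =
      (eval_nat scale p1 k * lam ^ k) * b1 + (eval_nat scale p2 k * lam ^ k) * b2 +
      ((b3 * nu ^ k) * eval_nat scale p3 k + (b4 * nu ^ k) * eval_nat scale p4 k) * l)"
proof -
  have dd: "direct_double Q l"
    and prod: "\<And>q r s t. q \<in> Q \<Longrightarrow> r \<in> Q \<Longrightarrow> s \<in> Q \<Longrightarrow> t \<in> Q \<Longrightarrow>
      (q + r * l) * (s + t * l) = (q * s + \<gamma> *s (conj t * r)) + (t * q + r * conj s) * l"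
    using cd unfolding cayley_dickson_double_def by simp_all
  have "\<forall>k. \<exists>u v. u \<in> Q \<and> v \<in> Q \<and> a k = u + v * l"
  proof
    fix k
    have "\<exists>!(q, r). q \<in> Q \<and> r \<in> Q \<and> a k = q + r * l"
      using dd unfolding direct_double_def by (rule spec)
    then show "\<exists>u v. u \<in> Q \<and> v \<in> Q \<and> a k = u + v * l" by (auto elim!: ex1E)
  qed
  then obtain u v where uv: "\<forall>k. u k \<in> Q \<and> v k \<in> Q \<and> a k = u k + v k * l" by metis
  then have uQ: "u k \<in> Q" and vQ: "v k \<in> Q" and ae: "a k = u k + v k * l" for k by simp_all
  have lm: "q * (s + t * l) = q * s + (t * q) * l" if "q \<in> Q" "s \<in> Q" "t \<in> Q" for q s t
    using prod[of q 0 s t] that by simp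
  have split: "q = s \<and> r = t" if "q \<in> Q" "r \<in> Q" "s \<in> Q" "t \<in> Q" "q + r * l = s + t * l" for q r s t
  proof -
    have "\<exists>!(q', r'). q' \<in> Q \<and> r' \<in> Q \<and> q + r * l = q' + r' * l"
      using dd unfolding direct_double_def by (rule spec)
    then have "(q, r) = (s, t)"
      by (rule ex1E) (use that in \<open>metis (mono_tags, lifting) case_prod_conv\<close>)
    then show ?thesis by simp
  qed
  have uvr: "u (k + 2) = (nu + lam) * u (k + 1) - (nu * lam) * u k \<and>
      v (k + 2) = v (k + 1) * (nu + lam) - v k * (nu * lam)" for k
  proof (rule split)
    have "(nu + lam) * a (k + 1) = (nu + lam) * u (k + 1) + (v (k + 1) * (nu + lam)) * l"
      unfolding ae by (rule lm) (use Q uQ vQ in simp_all)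
    moreover have "(nu * lam) * a k = (nu * lam) * u k + (v k * (nu * lam)) * l"
      unfolding ae by (rule lm) (use Q uQ vQ in simp_all)
    ultimately have "a (k + 2) = ((nu + lam) * u (k + 1) + (v (k + 1) * (nu + lam)) * l)
        - ((nu * lam) * u k + (v k * (nu * lam)) * l)"
      unfolding ar by (simp only:)
    also have "\<dots> = ((nu + lam) * u (k + 1) - (nu * lam) * u k) +
        (v (k + 1) * (nu + lam) - v k * (nu * lam)) * l"
      by (simp add: mult_diff_left)
    finally show "u (k + 2) + v (k + 2) * l = ((nu + lam) * u (k + 1) - (nu * lam) * u k) +
        (v (k + 1) * (nu + lam) - v k * (nu * lam)) * l"
      by (simp only: ae)
  qed (use Q uQ vQ in simp_all)
  obtain s t b b' where S: "s \<in> Q" "t \<in> Q" "b \<in> Q" "b' \<in> Q"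
    and us: "\<forall>k. u k = lam ^ k * b + ((s + of_nat k *s t) * lam ^ k) * b'"
    using left_recurrence_solution[OF Q lam0 tr nrm sc uQ conjunct1[OF uvr]] by blast
  obtain s' t' d d' where S': "s' \<in> Q" "t' \<in> Q" "d \<in> Q" "d' \<in> Q"
    and vs: "\<forall>k. v k = d * nu ^ k + (d' * nu ^ k) * (s' + of_nat k *s t')"
    using right_recurrence_solution[OF Q nu0 tr nrm sc vQ conjunct2[OF uvr]] by blast
  have lin: "linear_poly_over Q [:x, y:]" if "x \<in> Q" "y \<in> Q" for x y
    using that by (auto simp: linear_poly_over_def coeff_pCons split: nat.split)
  have one: "linear_poly_over Q [:1:]"
    by (auto simp: linear_poly_over_def coeff_pCons split: nat.split)
  have "\<forall>k. a k = (eval_nat scale [:1:] k * lam ^ k) * b + (eval_nat scale [:s, t:] k * lam ^ k) * b' +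
        ((d * nu ^ k) * eval_nat scale [:1:] k +
         (d' * nu ^ k) * eval_nat scale [:s', t':] k) * l"
    unfolding ae us[rule_format] vs[rule_format] eval_nat_linear eval_nat_one
    by (simp add: mult_one_left mult_one_right)
  with S(3,4) S'(3,4) lin[OF S(1,2)] lin[OF S'(1,2)] one
  have "b \<in> Q \<and> b' \<in> Q \<and> d \<in> Q \<and> d' \<in> Q \<and> linear_poly_over Q [:1:] \<and>
      linear_poly_over Q [:s, t:] \<and> linear_poly_over Q [:1:] \<and> linear_poly_over Q [:s', t':] \<and>
      (\<forall>k. a k = (eval_nat scale [:1:] k * lam ^ k) * b + (eval_nat scale [:s, t:] k * lam ^ k) * b' +
        ((d * nu ^ k) * eval_nat scale [:1:] k +
         (d' * nu ^ k) * eval_nat scale [:s', t':] k) * l)"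
    by (intro conjI)
  then show ?thesis by (intro exI)
qed

end

theorem theorem1p4:
  fixes scale :: "'f::field_char_0 \<Rightarrow> 'o::{ab_group_add, power} \<Rightarrow> 'o"
    and conj :: "'o \<Rightarrow> 'o"
    and c0 c1 lam :: 'o
    and a :: "nat \<Rightarrow> 'o"
  assumes "octonion_division_algebra scale conj"
    and "c0 \<noteq> 0"
    and "left_recurrence c0 c1 a"
    and "unique_root (recurrence_poly c0 c1) lam"
  shows "\<exists>mu. unique_root (map_poly conj (recurrence_poly c0 c1)) mu \<and>
    mu \<in> conjugacy_class lam \<and>
    (\<exists>Q \<gamma> l b1 b2 b3 b4 p1 p2 p3 p4.
       unital_algebra.quaternion_subalgebra scale Q \<and>
       (\<forall>n. coeff (recurrence_poly c0 c1) n \<in> Q) \<and>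
       l + conj l = 0 \<and>
       unital_algebra.cayley_dickson_double scale conj Q \<gamma> l \<and>
       b1 \<in> Q \<and> b2 \<in> Q \<and> b3 \<in> Q \<and> b4 \<in> Q \<and>
       linear_poly_over Q p1 \<and> linear_poly_over Q p2 \<and>
       linear_poly_over Q p3 \<and> linear_poly_over Q p4 \<and>
       (\<forall>k. a k =
          (eval_nat scale p1 k * lam ^ k) * b1 + (eval_nat scale p2 k * lam ^ k) * b2 +
          ((b3 * conj mu ^ k) * eval_nat scale p3 k +
           (b4 * conj mu ^ k) * eval_nat scale p4 k) * l))"
proof -
  interpret octonion_division_algebra scale conj by fact
  interpret octonion_division_algebra_char_0 scale conj by unfold_locales
  have c0: "c0 \<noteq> 0" and rec: "left_recurrence c0 c1 a"
    and root: "unique_root (recurrence_poly c0 c1) lam" by fact+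
  \<comment> \<open>the cofactor: \<open>x^2 + c1 x + c0 = (x - nu) * (x - lam)\<close>\<close>
  define nu where "nu = - c1 - lam"
  have r0: "c0 + c1 * lam + lam * lam = 0"
    and runiq: "\<And>w. c0 + c1 * w + w * w = 0 \<Longrightarrow> w = lam"
    using root unfolding unique_root_recurrence_poly by simp_all
  have c1: "c1 = - (nu + lam)" by (simp add: nu_def)
  have "c0 - nu * lam = 0"
    using r0 unfolding nu_def by (simp add: mult_diff_left algebra_simps)
  then have c0e: "c0 = nu * lam" by simp
  have lam0: "lam \<noteq> 0" and nu0: "nu \<noteq> 0" using c0 c0e by auto
  obtain Q l j where qs: "quaternion_subalgebra Q" and sub: "subalgebra Q"
    and as: "\<forall>x\<in>Q. \<forall>y\<in>Q. \<forall>z\<in>Q. (x * y) * z = x * (y * z)"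
    and Q: "lam \<in> Q" "nu \<in> Q" and l: "l + conj l = 0"
    and cd: "cayley_dickson_double conj Q (- nrm l) l"
    and j: "j \<noteq> 0" "tr j = 0" "bil j lam = 0"
    by (rule two_elements_quaternion[of lam nu])
  interpret octonion_associative_subalgebra scale conj Q
    using sub as by unfold_locales simp_all
  have uniq: "w = lam" if "w * w - (nu + lam) * w + nu * lam = 0" for w
  proof (rule runiq)
    have "c0 + c1 * w + w * w = w * w - (nu + lam) * w + nu * lam"
      unfolding c0e c1 by (simp add: mult_add_left mult_diff_left)
    then show "c0 + c1 * w + w * w = 0" by (simp only: that)
  qed
  note nec = sole_root_necessary[OF Q uniq]
  note tr = nec(1) and nrm = nec(2) and sc = nec(3)
  have sc': "conj lam = conj (conj nu) \<Longrightarrow> conj nu = conj (conj nu)"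
    using sc by (metis conj_conj)
  \<comment> \<open>conjugation reverses the factors: the conjugate polynomial is \<open>(x - conj lam) * (x - conj nu)\<close>\<close>
  define mu where "mu = conj nu"
  have root_mu: "unique_root (map_poly conj (recurrence_poly c0 c1)) mu"
    unfolding map_poly_conj_recurrence_poly unique_root_recurrence_poly
  proof (intro conjI allI impI)
    show "conj c0 + conj c1 * mu + mu * mu = 0"
      by (simp add: c0e c1 mu_def conj_simps mult_add_left mult_diff_left)
    fix w assume "conj c0 + conj c1 * w + w * w = 0"
    moreover have "conj c0 + conj c1 * w + w * w =
        w * w - (conj lam + conj nu) * w + conj lam * conj nu"
      by (simp add: c0e c1 conj_simps mult_add_left mult_diff_left)
    ultimately have "w * w - (conj lam + conj nu) * w + conj lam * conj nu = 0"
      by (simp only:)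
    then show "w = mu"
      unfolding mu_def
      by (intro sole_root_sufficient[OF Q_conj[OF Q(2)] Q_conj[OF Q(1)] _ _ sc']) (simp_all add: tr nrm)
  qed
  have class_mu: "mu \<in> conjugacy_class lam"
  proof (cases "nu = lam")
    case True
    \<comment> \<open>now \<open>mu = conj lam\<close>, and \<open>j\<close>, being orthogonal to 1 and \<open>lam\<close>,
        conjugates one to the other\<close>
    have "conj lam * j + conj j * lam = 0" using conj_mult_polar[of lam j] j by (simp add: bil_commute)
    then have "mu * j = j * lam" using True j by (simp add: mu_def conj_eq[of j])
    then show ?thesis using conjugate_in_class j by blast
  next
    case False
    have tm: "tr mu = tr lam" "nrm mu = nrm lam" by (simp_all add: mu_def tr nrm)
    have "mu * (mu - conj lam) = (mu - conj lam) * lam"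
      by (simp add: mult_diff_left mult_diff_right conj_mult_self)
        (simp add: conj_eq[of lam] mult_diff_right mult_scale_right mult_one_right square_eq[of mu] tm)
    moreover have "mu - conj lam \<noteq> 0" using False unfolding mu_def by (metis conj_conj right_minus_eq)
    ultimately show ?thesis using conjugate_in_class by blast
  qed
  have coeffs: "\<forall>n. coeff (recurrence_poly c0 c1) n \<in> Q"
    using Q by (auto simp: recurrence_poly_def c0e c1 coeff_pCons split: nat.split)
  have ar: "a (k + 2) = (nu + lam) * a (k + 1) - (nu * lam) * a k" for k
  proof -
    have "a (k + 2) = - (c0 * a k) - c1 * a (k + 1)"
      using rec unfolding left_recurrence_def by (rule spec)
    then show ?thesis unfolding c0e c1 by (simp only: mult_minus_left_alg) simp
  qed
  have sol: "\<exists>b1 b2 b3 b4 p1 p2 p3 p4.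
      b1 \<in> Q \<and> b2 \<in> Q \<and> b3 \<in> Q \<and> b4 \<in> Q \<and>
      linear_poly_over Q p1 \<and> linear_poly_over Q p2 \<and>
      linear_poly_over Q p3 \<and> linear_poly_over Q p4 \<and>
      (\<forall>k. a k =
        (eval_nat scale p1 k * lam ^ k) * b1 + (eval_nat scale p2 k * lam ^ k) * b2 +
        ((b3 * conj mu ^ k) * eval_nat scale p3 k + (b4 * conj mu ^ k) * eval_nat scale p4 k) * l)"
    using double_recurrence_solution[OF Q lam0 nu0 tr nrm sc cd ar] by (simp only: mu_def conj_conj)
  show ?thesis
  proof (rule exI[of _ mu], intro conjI)
    show "\<exists>Q \<gamma> l b1 b2 b3 b4 p1 p2 p3 p4.
       quaternion_subalgebra Q \<and>
       (\<forall>n. coeff (recurrence_poly c0 c1) n \<in> Q) \<and>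
       l + conj l = 0 \<and>
       cayley_dickson_double conj Q \<gamma> l \<and>
       b1 \<in> Q \<and> b2 \<in> Q \<and> b3 \<in> Q \<and> b4 \<in> Q \<and>
       linear_poly_over Q p1 \<and> linear_poly_over Q p2 \<and>
       linear_poly_over Q p3 \<and> linear_poly_over Q p4 \<and>
       (\<forall>k. a k =
          (eval_nat scale p1 k * lam ^ k) * b1 + (eval_nat scale p2 k * lam ^ k) * b2 +
          ((b3 * conj mu ^ k) * eval_nat scale p3 k +
           (b4 * conj mu ^ k) * eval_nat scale p4 k) * l)"
      using sol qs coeffs l cd
      by - (rule exI[of _ Q], rule exI[of _ "- nrm l"], rule exI[of _ l], elim exE, intro exI,
        intro conjI; (elim conjE)?; assumption)
  qed (fact root_mu, fact class_mu)
qed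

end
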